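(* Let $\mathbb{F}$ be a field of characteristic different from two, let $n\ge 3$, and let $\Phi\colon \mathrm{Mat}_n(\mathbb{F})\to \mathrm{Mat}_n(\mathbb{F})$ be an additive map such that $\Phi(\Lambda^1)\subseteq\Lambda^1$. Assume further that $\Phi$ is surjective, or that $\Phi$ preserves per-rank-one in both directions. Then there exist injective maps (i.e. permutations) $\sigma,\tau\colon[n]\to[n]$, so that $P_\sigma$ and $P_\tau$ are permutation matrices, diagonal matrices $D_1,D_2\in\mathrm{Mat}_n(\mathbb{F})$ with nonzero diagonal entries, and a nonzero field endomorphism $\varphi$ of $\mathbb{F}$ such that $$\Phi(A)=P_\sigma^{T}D_1A^{\varphi}D_2P_\tau\quad\text{for all }A\in\mathrm{Mat}_n(\mathbb{F}),$$ or $$\Phi(A)=P_\sigma^{T}D_1(A^{\varphi})^{T}D_2P_\tau\quad\text{for all }A\in\mathrm{Mat}_n(\mathbb{F}).$$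
   Context: $[n]=\{1,\dots,n\}$; $\mathrm{Mat}_n(\mathbb{F})$ is the set of $n\times n$ matrices over $\mathbb{F}$. The permanent of an $m\times m$ matrix $A=(a_{ij})$ is $\mathrm{per}(A)=\sum_{\pi\in S_m}\prod_{i=1}^m a_{i\pi(i)}$. The permanent rank $\mathrm{prk}(A)$ of $A\in\mathrm{Mat}_n(\mathbb{F})$ is the size of the largest square submatrix of $A$ with nonzero permanent (and $\mathrm{prk}(0)=0$). $\Lambda^1=\{A\in\mathrm{Mat}_n(\mathbb{F}) : \mathrm{prk}(A)=1\}$. $\Phi$ preserves per-rank-one in both directions if for every $A\in\mathrm{Mat}_n(\mathbb{F})$: $A\in\Lambda^1$ if and only if $\Phi(A)\in\Lambda^1$. $E_{ij}$ are the standard matrix units. For a map $\sigma\colon[n]\to[n]$, $P_\sigma=\sum_{i=1}^nE_{i\sigma(i)}$. A field endomorphism is an additive and multiplicative map $\varphi\colon\mathbb{F}\to\mathbb{F}$; for $A=(a_{ij})$, $A^\varphi=(\varphi(a_{ij}))$. "Additive" means $\Phi(A+B)=\Phi(A)+\Phi(B)$. *)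

theory Defs
  imports
    "HOL-Combinatorics.Permutations"
    "HOL-Library.FuncSet"
    "Jordan_Normal_Form.Matrix"
    "Jordan_Normal_Form.DL_Submatrix"
begin

text \<open>
  Matrices are those of \<^theory>\<open>Jordan_Normal_Form.Matrix\<close>, so rows and columns are
  indexed by \<^term>\<open>{..<n}\<close> instead of $\{1,\dots,n\}$.
\<close>

text \<open>As for the library's determinant, the value at a non-square matrix is 0 by convention.\<close>

definition permanent :: "'a mat \<Rightarrow> 'a :: comm_ring_1" where
  "permanent A =
    (if dim_row A = dim_col A
     then \<Sum>p \<in> {p. p permutes {0..<dim_row A}}. \<Prod>i = 0..<dim_row A. A $$ (i, p i)
     else 0)"

text \<open>
  The value \<^term>\<open>m = 0\<close> always belongs to the set (the empty matrix has permanent 1), so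
  that the permanent rank of the zero matrix is 0.
\<close>

definition permanent_rank :: "'a :: comm_ring_1 mat \<Rightarrow> nat" where
  "permanent_rank A =
    Max {m. \<exists>I J. I \<subseteq> {..<dim_row A} \<and> J \<subseteq> {..<dim_col A} \<and>
                  card I = m \<and> card J = m \<and> permanent (submatrix A I J) \<noteq> 0}"

definition per_rank_one :: "nat \<Rightarrow> 'a :: comm_ring_1 mat set" where
  "per_rank_one n = {A \<in> carrier_mat n n. permanent_rank A = 1}"

definition preserves_per_rank_one_both ::
    "nat \<Rightarrow> ('a :: comm_ring_1 mat \<Rightarrow> 'a mat) \<Rightarrow> bool" where
  "preserves_per_rank_one_both n \<Phi> \<longleftrightarrow>
    (\<forall>A \<in> carrier_mat n n. A \<in> per_rank_one n \<longleftrightarrow> \<Phi> A \<in> per_rank_one n)"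

definition additive_on_mat :: "nat \<Rightarrow> ('a :: comm_ring_1 mat \<Rightarrow> 'a mat) \<Rightarrow> bool" where
  "additive_on_mat n \<Phi> \<longleftrightarrow>
    (\<forall>A \<in> carrier_mat n n. \<forall>B \<in> carrier_mat n n. \<Phi> (A + B) = \<Phi> A + \<Phi> B)"

definition matrix_unit :: "nat \<Rightarrow> nat \<Rightarrow> nat \<Rightarrow> 'a :: comm_ring_1 mat" where
  "matrix_unit n i j = mat n n (\<lambda>(r, s). if r = i \<and> s = j then 1 else 0)"

text \<open>
  The sum of the matrix units at the positions $(i, \sigma(i))$, taken entrywise because
  matrices of varying dimension form no additive monoid type.
\<close>

definition map_matrix :: "nat \<Rightarrow> (nat \<Rightarrow> nat) \<Rightarrow> 'a :: comm_ring_1 mat" where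
  "map_matrix n \<sigma> = mat n n (\<lambda>(r, s). \<Sum>i<n. matrix_unit n i (\<sigma> i) $$ (r, s))"

definition nonzero_diagonal :: "nat \<Rightarrow> 'a :: comm_ring_1 mat \<Rightarrow> bool" where
  "nonzero_diagonal n D \<longleftrightarrow>
    D \<in> carrier_mat n n \<and> diagonal_mat D \<and> (\<forall>i<n. D $$ (i, i) \<noteq> 0)"

text \<open>
  Preservation of 1 is not required, so the zero map is an endomorphism in this sense;
  the locale \<^locale>\<open>field_hom\<close> would exclude it.
\<close>

definition field_endomorphism :: "('a :: field \<Rightarrow> 'a) \<Rightarrow> bool" where
  "field_endomorphism \<phi> \<longleftrightarrow>
    (\<forall>x y. \<phi> (x + y) = \<phi> x + \<phi> y) \<and> (\<forall>x y. \<phi> (x * y) = \<phi> x * \<phi> y)"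

end

theory Submission
  imports Defs "HOL-Library.Function_Algebras"
begin

text \<open>
  Since 2 is invertible, a nonzero matrix has permanent rank 1 iff all its 2 by 2 subpermanents
  vanish: composition with a transposition pairs off the terms of a larger permanent. These
  subpermanents are quadratic forms, so an additive group of such matrices is totally isotropic for
  their polar forms; it therefore lies in one row, in one column, or in a 2-dimensional space of
  matrices supported in a 2 by 2 block.

  Apply this to the images of the matrices supported in one row. If the map is surjective, these
  n images must span a space of dimension n * n, so each is a full row or a full column and they
  are independent. If the map preserves per-rank-one in both directions, the polar forms take
  nonzero values on the images of E_im and E_kl for distinct m and l, which forces the images of
  three units of a row to be linearly independent. In both cases rows go injectively to
  rows, or to columns. The same holds for columns, so that up to transposition each x E_ij goes to
  a multiple g_ij(x) of E_(sigma i, tau j). The 2 by 2 blocks with entries x, y, z, w and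
  x w + y z = 0 then give g_ij(x) = d_i phi(x) e_j with phi multiplicative.
\<close>

section \<open>Entry functions, their 2 by 2 subpermanents and the polar forms of these\<close>

definition tr :: "(nat \<Rightarrow> nat \<Rightarrow> 'a) \<Rightarrow> nat \<Rightarrow> nat \<Rightarrow> 'a" where
  "tr f = (\<lambda>i j. f j i)"

definition in_row :: "nat \<Rightarrow> (nat \<Rightarrow> nat \<Rightarrow> 'a::zero) \<Rightarrow> bool" where
  "in_row a f \<longleftrightarrow> (\<forall>p q. p \<noteq> a \<longrightarrow> f p q = 0)"

text \<open>The indices range over all natural numbers: for a function that vanishes outside an
  \<open>n\<close> by \<open>n\<close> square the additional conditions hold trivially, so no
  dimension has to be carried along.\<close>

definition perm2_zero :: "(nat \<Rightarrow> nat \<Rightarrow> 'a::field) \<Rightarrow> bool" where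
  "perm2_zero f \<longleftrightarrow> (\<forall>i k j l. i \<noteq> k \<longrightarrow> j \<noteq> l \<longrightarrow> f i j * f k l + f i l * f k j = 0)"

lemma tr_apply [simp]: "tr f i j = f j i"
  by (simp add: tr_def)

lemma tr_tr [simp]: "tr (tr f) = f"
  by (simp add: tr_def)

lemma tr_add: "tr (f + g) = tr f + tr g"
  by (simp add: fun_eq_iff)

lemma perm2_zeroD: "perm2_zero f \<Longrightarrow> i \<noteq> k \<Longrightarrow> j \<noteq> l \<Longrightarrow> f i j * f k l + f i l * f k j = 0"
  unfolding perm2_zero_def by blast

lemma perm2_zero_tr [simp]: "perm2_zero (tr f) \<longleftrightarrow> perm2_zero f"
proof -
  have "perm2_zero (tr g)" if "perm2_zero g" for g :: "nat \<Rightarrow> nat \<Rightarrow> 'a"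
    unfolding perm2_zero_def tr_apply
  proof (intro allI impI)
    fix i k j l :: nat
    assume "i \<noteq> k" "j \<noteq> l"
    from perm2_zeroD[OF that this(2) this(1)] show "g j i * g l k + g l i * g j k = 0"
      by (simp add: mult.commute)
  qed
  from this[of f] this[of "tr f"] show ?thesis by auto
qed

lemma perm2_zero_in_row: "in_row a f \<Longrightarrow> perm2_zero f"
proof -
  assume r: "in_row a f"
  have "f i j * f k l + f i l * f k j = 0" if "i \<noteq> k" for i j k l
  proof (cases "i = a")
    case True
    hence "f k q = 0" for q using r that by (auto simp: in_row_def)
    thus ?thesis by simp
  next
    case False
    hence "f i q = 0" for q using r by (auto simp: in_row_def)
    thus ?thesis by simp
  qed
  thus "perm2_zero f" unfolding perm2_zero_def by blast
qed

text \<open>Polarisation: the left-hand side is \<open>Q (f + g) - Q f - Q g\<close> for the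
  quadratic form \<open>Q\<close> given by the subpermanent on rows \<open>i\<close>,
  \<open>k\<close> and columns \<open>j\<close>, \<open>l\<close>.\<close>

lemma perm2_zero_polar:
  assumes "perm2_zero f" "perm2_zero g" "perm2_zero (f + g)" "i \<noteq> k" "j \<noteq> l"
  shows "f i j * g k l + f k l * g i j + f i l * g k j + f k j * g i l = 0"
proof -
  have "f i j * g k l + f k l * g i j + f i l * g k j + f k j * g i l
    = ((f + g) i j * (f + g) k l + (f + g) i l * (f + g) k j)
      - (f i j * f k l + f i l * f k j) - (g i j * g k l + g i l * g k j)"
    by (simp add: algebra_simps)
  thus ?thesis using perm2_zeroD[OF assms(1,4,5)] perm2_zeroD[OF assms(2,4,5)] perm2_zeroD[OF assms(3,4,5)] by simp
qed

section \<open>Additive families with vanishing subpermanents\<close>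

text \<open>Three vectors cannot have pairwise opposite ratios in two columns: the relations at
  \<open>j\<close> and \<open>l\<close> combine to \<open>2 * (x j * (y l * z j)) = 0\<close>, so
  \<open>x j = 0\<close>, and \<open>x l = 0\<close> follows. The relation at \<open>q\<close> and
  \<open>l\<close> with \<open>y l \<noteq> 0\<close> carries this to every
  \<open>q\<close>.\<close>

lemma pairwise_anti_zero:
  fixes x y z :: "nat \<Rightarrow> 'a::field"
  assumes two: "(2::'a) \<noteq> 0"
    and nz: "y j \<noteq> 0" "y l \<noteq> 0" "z j \<noteq> 0" "z l \<noteq> 0"
    and yz: "y j * z l + y l * z j = 0" and "j \<noteq> l"
    and xy: "\<And>q r. q \<noteq> r \<Longrightarrow> x q * y r + x r * y q = 0"
    and xz: "\<And>q r. q \<noteq> r \<Longrightarrow> x q * z r + x r * z q = 0"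
  shows "x q = 0"
proof -
  have 1: "x j * y l + x l * y j = 0" and 2: "x j * z l + x l * z j = 0"
    using xy xz \<open>j \<noteq> l\<close> by auto
  have "2 * (x j * (y l * z j)) = z j * (x j * y l + x l * y j) - y j * (x j * z l + x l * z j)
      + x j * (y j * z l + y l * z j)" by (simp add: algebra_simps)
  hence "x j = 0" using 1 2 yz two nz by simp
  hence "x l = 0" using 1 nz by simp
  show ?thesis
    using xy[of q l] \<open>x j = 0\<close> \<open>x l = 0\<close> nz by (cases "q = l") auto
qed

text \<open>Rows \<open>i\<close> and \<open>k\<close> of \<open>A\<close> serve as \<open>y\<close>
  and \<open>z\<close> in \<open>pairwise_anti_zero\<close>, first for row \<open>p\<close> of
  \<open>A\<close> itself. Once that row is zero, the polar form of \<open>A\<close> and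
  \<open>B\<close> on row \<open>p\<close> and one of these rows reduces to the same relation for
  row \<open>p\<close> of \<open>B\<close>.\<close>

lemma outside_block_row:
  fixes A B :: "nat \<Rightarrow> nat \<Rightarrow> 'a::field"
  assumes two: "(2::'a) \<noteq> 0" and perm2_zero: "perm2_zero A" "perm2_zero B" "perm2_zero (A + B)"
    and ij: "i \<noteq> k" "j \<noteq> l"
    and nz: "A i j \<noteq> 0" "A i l \<noteq> 0" "A k j \<noteq> 0" "A k l \<noteq> 0"
    and p: "p \<noteq> i" "p \<noteq> k"
  shows "B p q = 0"
proof -
  have yz: "A i j * A k l + A i l * A k j = 0" using perm2_zeroD perm2_zero ij by blast
  have A0: "A p r = 0" for r
    using pairwise_anti_zero[OF two nz yz ij(2), of "A p"] perm2_zeroD[OF perm2_zero(1) p(1)] perm2_zeroD[OF perm2_zero(1) p(2)]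
    by blast
  have "B p r * A i s + B p s * A i r = 0" if "r \<noteq> s" for r s
    using perm2_zero_polar[OF perm2_zero p(1) that] A0 by (simp add: algebra_simps)
  moreover have "B p r * A k s + B p s * A k r = 0" if "r \<noteq> s" for r s
    using perm2_zero_polar[OF perm2_zero p(2) that] A0 by (simp add: algebra_simps)
  ultimately show ?thesis
    using pairwise_anti_zero[OF two nz yz ij(2), of "B p"] by blast
qed

lemma outside_block_col:
  fixes A B :: "nat \<Rightarrow> nat \<Rightarrow> 'a::field"
  assumes two: "(2::'a) \<noteq> 0" and perm2_zero: "perm2_zero A" "perm2_zero B" "perm2_zero (A + B)"
    and ij: "i \<noteq> k" "j \<noteq> l"
    and nz: "A i j \<noteq> 0" "A i l \<noteq> 0" "A k j \<noteq> 0" "A k l \<noteq> 0"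
    and q: "q \<noteq> j" "q \<noteq> l"
  shows "B p q = 0"
proof -
  have "perm2_zero (tr A + tr B)" using perm2_zero(3) by (simp flip: tr_add)
  hence "tr B q p = 0"
    by (intro outside_block_row[OF two, of "tr A" "tr B" j l i k q p])
      (simp_all add: perm2_zero ij nz q)
  thus ?thesis by simp
qed

text \<open>The sets in question are closed under addition only and need not be subspaces, so
  containment in a span is recorded; the two spanning functions need not belong to the set.\<close>

definition two_span :: "(nat \<Rightarrow> nat \<Rightarrow> 'a::field) set \<Rightarrow> bool" where
  "two_span S \<longleftrightarrow> (\<exists>u v. \<forall>f\<in>S. \<exists>\<alpha> \<beta>. \<forall>p q. f p q = \<alpha> * u p q + \<beta> * v p q)"

lemma two_span_tr: "two_span (tr ` S) \<Longrightarrow> two_span S"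
proof -
  assume "two_span (tr ` S)"
  then obtain u v where uv: "\<forall>f\<in>tr ` S. \<exists>\<alpha> \<beta>. \<forall>p q. f p q = \<alpha> * u p q + \<beta> * v p q"
    unfolding two_span_def by blast
  have "\<exists>\<alpha> \<beta>. \<forall>p q. f p q = \<alpha> * tr u p q + \<beta> * tr v p q" if "f \<in> S" for f
  proof -
    from uv that obtain \<alpha> \<beta> where "\<forall>p q. tr f p q = \<alpha> * u p q + \<beta> * v p q" by blast
    hence "\<forall>p q. f p q = \<alpha> * tr u p q + \<beta> * tr v p q" by simp
    thus ?thesis by blast
  qed
  thus ?thesis unfolding two_span_def by blast
qed

text \<open>By \<open>pj\<close> and \<open>pl\<close>, columns \<open>j\<close> and
  \<open>l\<close> of every \<open>B\<close> are multiples of those of \<open>A\<close>. The two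
  block columns of \<open>A\<close>, extended by zero, are the spanning functions.\<close>

lemma two_span_cols:
  fixes A :: "nat \<Rightarrow> nat \<Rightarrow> 'a::field"
  assumes ij: "i \<noteq> k" "j \<noteq> l" and nz: "A i j \<noteq> 0" "A i l \<noteq> 0"
    and out: "\<And>B p q. B \<in> S \<Longrightarrow> p \<notin> {i, k} \<or> q \<notin> {j, l} \<Longrightarrow> B p q = 0"
    and pj: "\<And>B. B \<in> S \<Longrightarrow> B k j * A i j = B i j * A k j"
    and pl: "\<And>B. B \<in> S \<Longrightarrow> B k l * A i l = B i l * A k l"
  shows "two_span S"
  unfolding two_span_def
proof (intro exI ballI allI)
  fix B p q assume B: "B \<in> S"
  show "B p q = (B i j / A i j) * (if p \<in> {i, k} \<and> q = j then A p j else 0)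
    + (B i l / A i l) * (if p \<in> {i, k} \<and> q = l then A p l else 0)"
    using out[OF B, of p q] pj[OF B] pl[OF B] ij nz by (auto simp: field_simps)
qed

text \<open>\<open>A\<close> confines all of \<open>S\<close> to its own block. There
  \<open>c B = 0\<close> says that column \<open>l\<close> of \<open>B\<close> is parallel to that
  of \<open>A\<close>, and \<open>r B = 0\<close> says the same about row \<open>k\<close>. Since
  \<open>S\<close> is totally isotropic, one of these two linear forms vanishes on all of
  \<open>S\<close>.\<close>

lemma two_span_block:
  fixes A :: "nat \<Rightarrow> nat \<Rightarrow> 'a::field"
  assumes two: "(2::'a) \<noteq> 0" and AS: "A \<in> S"
    and S: "\<And>f. f \<in> S \<Longrightarrow> perm2_zero f" "\<And>f g. f \<in> S \<Longrightarrow> g \<in> S \<Longrightarrow> f + g \<in> S"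
    and ij: "i \<noteq> k" "j \<noteq> l" and nz: "A i j \<noteq> 0" "A k l \<noteq> 0"
  shows "two_span S"
proof -
  have A0: "A i j * A k l + A i l * A k j = 0" using perm2_zeroD S AS ij by blast
  hence nz': "A i j \<noteq> 0" "A i l \<noteq> 0" "A k j \<noteq> 0" "A k l \<noteq> 0" using nz by auto
  have out: "B p q = 0" if "B \<in> S" "p \<notin> {i, k} \<or> q \<notin> {j, l}" for B p q
    using that outside_block_row[OF two S(1)[OF AS] S(1)[OF that(1)] S(1)[OF S(2)[OF AS that(1)]] ij nz']
      outside_block_col[OF two S(1)[OF AS] S(1)[OF that(1)] S(1)[OF S(2)[OF AS that(1)]] ij nz'] by auto
  have pol: "f i j * g k l + f k l * g i j + f i l * g k j + f k j * g i l = 0" if "f \<in> S" "g \<in> S" for f g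
    using perm2_zero_polar[OF _ _ _ ij] S that by blast
  define c where "c B = B k l * A i l - B i l * A k l" for B :: "nat \<Rightarrow> nat \<Rightarrow> 'a"
  define r where "r B = B k l * A k j - B k j * A k l" for B :: "nat \<Rightarrow> nat \<Rightarrow> 'a"
  \<comment> \<open>On the orthogonal complement of \<open>A\<close> the quadratic form of the block splits as \<open>c * r\<close>.\<close>
  have cr: "c f * r g + c g * r f = 0" if fg: "f \<in> S" "g \<in> S" for f g
  proof -
    have "c f * r g + c g * r f
      = (A k l)\<^sup>2 * (f i j * g k l + f k l * g i j + f i l * g k j + f k j * g i l)
        - A k l * g k l * (A i j * f k l + A k l * f i j + A i l * f k j + A k j * f i l)
        - A k l * f k l * (A i j * g k l + A k l * g i j + A i l * g k j + A k j * g i l)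
        + 2 * f k l * g k l * (A i j * A k l + A i l * A k j)"
      unfolding c_def r_def by (simp add: algebra_simps power2_eq_square)
    thus ?thesis unfolding pol[OF fg] pol[OF AS fg(1)] pol[OF AS fg(2)] A0 by simp
  qed
  show ?thesis
  proof (cases "\<forall>B\<in>S. c B = 0")
    case True
    show ?thesis
    proof (rule two_span_cols[of i k j l A, OF ij nz'(1,2)])
      fix B p q assume "B \<in> S" "p \<notin> {i, k} \<or> q \<notin> {j, l}"
      thus "B p q = 0" by (rule out)
    next
      fix B assume B: "B \<in> S"
      show H: "B k l * A i l = B i l * A k l" using True B by (auto simp: c_def)
      \<comment> \<open>\<open>H\<close> is proportionality in column \<open>l\<close>;
        orthogonality to \<open>A\<close> and the vanishing subpermanent of \<open>A\<close>
        transfer it to column \<open>j\<close>.\<close>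
      have "(A i l)\<^sup>2 * (B k j * A i j - B i j * A k j)
        = A i l * A i j * (A i j * B k l + A k l * B i j + A i l * B k j + A k j * B i l)
          - (A i l * B i j + A i j * B i l) * (A i j * A k l + A i l * A k j)
          - (A i j)\<^sup>2 * (B k l * A i l - B i l * A k l)"
        by (simp add: algebra_simps power2_eq_square)
      hence "(A i l)\<^sup>2 * (B k j * A i j - B i j * A k j) = 0"
        unfolding pol[OF AS B] A0 H by simp
      thus "B k j * A i j = B i j * A k j" using nz' by simp
    qed
  next
    case False
    then obtain C where C: "C \<in> S" "c C \<noteq> 0" by blast
    \<comment> \<open>Pairing \<open>C\<close> with itself gives \<open>r C = 0\<close>; pairing it
      with any \<open>B\<close> then gives \<open>r B = 0\<close>.\<close>
    have "2 * (c C * r C) = 0" using cr[OF C(1) C(1)] by simp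
    hence "r C = 0" using C two by simp
    hence r0: "r B = 0" if "B \<in> S" for B using cr[OF C(1) that] C by simp
    have "two_span (tr ` S)"
    proof (rule two_span_cols[of j l i k "tr A"])
      fix B assume B: "B \<in> tr ` S"
      then obtain B' where B': "B' \<in> S" "B = tr B'" by blast
      have 1: "B' k l * A k j = B' k j * A k l" using r0[OF B'(1)] by (simp add: r_def)
      have "(A k j)\<^sup>2 * (B' i l * A i j - B' i j * A i l)
        = A k j * A i j * (A i j * B' k l + A k l * B' i j + A i l * B' k j + A k j * B' i l)
          - (A k j * B' i j + A i j * B' k j) * (A i j * A k l + A i l * A k j)
          - (A i j)\<^sup>2 * (B' k l * A k j - B' k j * A k l)"
        by (simp add: algebra_simps power2_eq_square)
      hence "(A k j)\<^sup>2 * (B' i l * A i j - B' i j * A i l) = 0"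
        unfolding pol[OF AS B'(1)] A0 1 by simp
      thus "B l i * tr A j i = B j i * tr A l i" using nz' B' by simp
      show "B l k * tr A j k = B j k * tr A l k" using 1 B' by simp
    next
      fix B p q assume "B \<in> tr ` S" "p \<notin> {j, l} \<or> q \<notin> {i, k}"
      thus "B p q = 0" using out by fastforce
    qed (use ij nz' in simp_all)
    thus ?thesis by (rule two_span_tr)
  qed
qed

text \<open>If one element has nonzero entries in different rows and columns,
  \<open>two_span_block\<close> applies. Otherwise nonzero positions of any two elements share a row
  or a column, because else the sum would have both entries nonzero. Positions that pairwise share a
  line all lie in one line.\<close>

lemma additive_perm2_zero_classify:
  fixes S :: "(nat \<Rightarrow> nat \<Rightarrow> 'a::field) set"
  assumes two: "(2::'a) \<noteq> 0"
    and S: "\<And>f. f \<in> S \<Longrightarrow> perm2_zero f" "\<And>f g. f \<in> S \<Longrightarrow> g \<in> S \<Longrightarrow> f + g \<in> S"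
  shows "(\<exists>a. \<forall>f\<in>S. in_row a f) \<or> (\<exists>b. \<forall>f\<in>S. in_row b (tr f)) \<or> two_span S"
proof (cases "\<exists>f\<in>S. \<exists>i k j l. i \<noteq> k \<and> j \<noteq> l \<and> f i j \<noteq> 0 \<and> f k l \<noteq> 0")
  case True
  thus ?thesis using two_span_block[OF two _ S] by blast
next
  case False
  have gen: "f i j = 0 \<or> g k l = 0" if "f \<in> S" "g \<in> S" "i \<noteq> k" "j \<noteq> l" for f g i j k l
  proof (rule ccontr)
    assume "\<not> ?thesis"
    hence nz: "f i j \<noteq> 0" "g k l \<noteq> 0" by auto
    have "f k l = 0" "g i j = 0" using False that nz by metis+
    hence "(f + g) i j \<noteq> 0" "(f + g) k l \<noteq> 0" using nz by simp_all
    thus False using False S(2)[OF that(1,2)] that(3,4) by metis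
  qed
  show ?thesis
  proof (cases "\<forall>f\<in>S. in_row 0 f")
    case False
    then obtain f i j where f: "f \<in> S" "f i j \<noteq> 0" unfolding in_row_def by blast
    show ?thesis
    proof (cases "\<forall>f\<in>S. in_row i f")
      case False
      then obtain g k l where g: "g \<in> S" "g k l \<noteq> 0" "k \<noteq> i" unfolding in_row_def by blast
      have "l = j" using gen[OF f(1) g(1), of i k j l] f g by auto
      \<comment> \<open>A nonzero entry outside column \<open>j\<close> would have to lie in row
        \<open>i\<close> and in row \<open>k\<close> at once.\<close>
      have "h m q = 0" if "h \<in> S" "q \<noteq> j" for h m q
        using gen[OF f(1) that(1), of i m j q] gen[OF g(1) that(1), of k m j q] f g that \<open>l = j\<close> by auto
      hence "\<forall>f\<in>S. in_row j (tr f)" by (auto simp: in_row_def)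
      thus ?thesis by blast
    qed blast
  qed blast
qed

section \<open>Additive preservers on functions supported in a square\<close>

text \<open>Unlike \<open>mat\<close>, these functions belong to a type with pointwise addition, so
  that sums, spans and dimension counts are available.\<close>

definition fmat :: "nat \<Rightarrow> (nat \<Rightarrow> nat \<Rightarrow> 'a::zero) set" where
  "fmat n = {f. \<forall>i j. i < n \<and> j < n \<or> f i j = 0}"

definition single :: "nat \<Rightarrow> nat \<Rightarrow> 'a::zero \<Rightarrow> nat \<Rightarrow> nat \<Rightarrow> 'a" where
  "single i j x = (\<lambda>p q. if p = i \<and> q = j then x else 0)"

definition row_mats :: "nat \<Rightarrow> nat \<Rightarrow> (nat \<Rightarrow> nat \<Rightarrow> 'a::zero) set" where
  "row_mats n i = {f \<in> fmat n. in_row i f}"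

text \<open>By \<open>per_rank_one_iff_perm2_zero\<close> the last clause is preservation of
  permanent rank one; nothing is said about arguments outside \<open>fmat n\<close>.\<close>

definition preserver :: "nat \<Rightarrow> ((nat \<Rightarrow> nat \<Rightarrow> 'a::field) \<Rightarrow> nat \<Rightarrow> nat \<Rightarrow> 'a) \<Rightarrow> bool" where
  "preserver n F \<longleftrightarrow> (\<forall>f\<in>fmat n. F f \<in> fmat n) \<and> (\<forall>f\<in>fmat n. \<forall>g\<in>fmat n. F (f + g) = F f + F g)
    \<and> (\<forall>f\<in>fmat n. perm2_zero f \<longrightarrow> f \<noteq> 0 \<longrightarrow> perm2_zero (F f) \<and> F f \<noteq> 0)"

lemma sum_fun2_apply: "sum f A p q = (\<Sum>a\<in>A. f a p q)"
  by (induction A rule: infinite_finite_induct) auto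

lemma single_apply: "single i j x p q = (if p = i \<and> q = j then x else 0)"
  by (simp add: single_def)

lemma single_eq_0_iff [simp]: "single i j x = 0 \<longleftrightarrow> x = 0"
  by (auto simp: single_def fun_eq_iff)

lemma single_add: "single i j (x + y :: 'a::monoid_add) = single i j x + single i j y"
  by (auto simp: single_def fun_eq_iff)

lemma tr_single [simp]: "tr (single i j x) = single j i x"
  by (auto simp: single_def fun_eq_iff)

lemma tr_eq_0_iff [simp]: "tr f = 0 \<longleftrightarrow> f = 0"
  by (auto simp: fun_eq_iff)

lemma fmat_add: "f \<in> fmat n \<Longrightarrow> g \<in> fmat n \<Longrightarrow> f + g \<in> fmat n" for f :: "nat \<Rightarrow> nat \<Rightarrow> 'a::monoid_add"
  unfolding fmat_def mem_Collect_eq plus_fun_apply by (metis add_0)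

lemma fmat_zero [simp]: "0 \<in> fmat n"
  by (simp add: fmat_def)

lemma fmat_tr [simp]: "tr f \<in> fmat n \<longleftrightarrow> f \<in> fmat n"
  by (auto simp: fmat_def)

lemma in_row_add: "in_row a f \<Longrightarrow> in_row a g \<Longrightarrow> in_row a (f + g)" for f :: "nat \<Rightarrow> nat \<Rightarrow> 'a::monoid_add"
  by (simp add: in_row_def)

lemma rows_add: "f \<in> row_mats n i \<Longrightarrow> g \<in> row_mats n i \<Longrightarrow> f + g \<in> row_mats n i" for f :: "nat \<Rightarrow> nat \<Rightarrow> 'a::monoid_add"
  by (simp add: row_mats_def fmat_add in_row_add)

lemma single_in_rows [simp]: "i < n \<Longrightarrow> j < n \<Longrightarrow> single i j x \<in> row_mats n i"
  by (auto simp: row_mats_def fmat_def in_row_def single_def)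

lemma rows_fmat: "f \<in> row_mats n i \<Longrightarrow> f \<in> fmat n"
  by (simp add: row_mats_def)

lemma single_in_fmat [simp]: "i < n \<Longrightarrow> j < n \<Longrightarrow> single i j x \<in> fmat n"
  using rows_fmat single_in_rows by blast

lemma perm2_zero_rows: "f \<in> row_mats n i \<Longrightarrow> perm2_zero f"
  by (auto simp: row_mats_def intro: perm2_zero_in_row)

lemma perm2_zero_single [simp]: "perm2_zero (single i j x)"
  by (rule perm2_zero_in_row[of i]) (simp add: in_row_def single_def)

lemma preserver_add: "preserver n F \<Longrightarrow> f \<in> fmat n \<Longrightarrow> g \<in> fmat n \<Longrightarrow> F (f + g) = F f + F g"
  by (simp add: preserver_def)

lemma preserver_fmat: "preserver n F \<Longrightarrow> f \<in> fmat n \<Longrightarrow> F f \<in> fmat n"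
  by (simp add: preserver_def)

lemma preserver_nonzero: "preserver n F \<Longrightarrow> f \<in> fmat n \<Longrightarrow> perm2_zero f \<Longrightarrow> f \<noteq> 0 \<Longrightarrow> F f \<noteq> 0"
  by (simp add: preserver_def)

lemma preserver_zero: "preserver n F \<Longrightarrow> F 0 = 0"
  using preserver_add[of n F 0 0] by simp

lemma perm2_zero_zero [simp]: "perm2_zero 0"
  by (simp add: perm2_zero_def)

lemma preserver_perm2_zero: "preserver n F \<Longrightarrow> f \<in> fmat n \<Longrightarrow> perm2_zero f \<Longrightarrow> perm2_zero (F f)"
  by (metis perm2_zero_zero preserver_def preserver_zero)

lemma preserver_tr_comp: "preserver n F \<Longrightarrow> preserver n (\<lambda>f. tr (F f))"
  by (simp add: preserver_def tr_add)

lemma preserver_comp_tr: "preserver n F \<Longrightarrow> preserver n (\<lambda>f. F (tr f))"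
  by (simp add: preserver_def tr_add)

lemma preserver_sum:
  assumes "preserver n F" "\<And>m. m \<in> M \<Longrightarrow> h m \<in> fmat n"
  shows "F (sum h M) = (\<Sum>m\<in>M. F (h m))"
proof -
  have "sum h M \<in> fmat n \<and> F (sum h M) = (\<Sum>m\<in>M. F (h m))"
    using assms(2)
    by (induction M rule: infinite_finite_induct)
      (auto simp: preserver_zero[OF assms(1)] preserver_add[OF assms(1)] fmat_add)
  thus ?thesis ..
qed

text \<open>The functions supported in one row form an additive family with vanishing subpermanents,
  and \<open>F\<close> carries it to another such family. The last alternative is the one that
  surjectivity or \<open>separating\<close> has to exclude.\<close>

lemma preserver_rows_classify:
  assumes two: "(2::'a::field) \<noteq> 0" and F: "preserver n F"
  shows "(\<exists>a. \<forall>f\<in>row_mats n i. in_row a (F f)) \<or> (\<exists>b. \<forall>f\<in>row_mats n i. in_row b (tr (F f)))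
    \<or> two_span (F ` (row_mats n i :: (nat \<Rightarrow> nat \<Rightarrow> 'a) set))"
proof -
  have "perm2_zero f" if "f \<in> F ` row_mats n i" for f
    using that F by (auto intro: preserver_perm2_zero perm2_zero_rows rows_fmat)
  moreover have "f + g \<in> F ` row_mats n i" if "f \<in> F ` row_mats n i" "g \<in> F ` row_mats n i" for f g
  proof -
    from that obtain f' g' where "f = F f'" "g = F g'" "f' \<in> row_mats n i" "g' \<in> row_mats n i" by blast
    thus ?thesis using preserver_add[OF F] rows_add rows_fmat by (metis image_eqI)
  qed
  ultimately show ?thesis using additive_perm2_zero_classify[OF two, of "F ` row_mats n i"] by auto
qed

lemma preserver_row_index_less:
  assumes F: "preserver n F" and i: "i < n" and r: "\<forall>f\<in>row_mats n i. in_row a (F f)"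
  shows "a < n"
proof -
  let ?e = "single i i 1"
  have "F ?e \<noteq> 0" using i by (intro preserver_nonzero[OF F]) simp_all
  then obtain p q where "F ?e p q \<noteq> 0" by (auto simp: fun_eq_iff)
  moreover have "in_row a (F ?e)" using r i by simp
  moreover have "F ?e \<in> fmat n" using i by (intro preserver_fmat[OF F]) simp_all
  ultimately show ?thesis unfolding in_row_def fmat_def mem_Collect_eq by metis
qed

section \<open>Rows sent injectively to parallel lines\<close>

text \<open>Transposing the values or the argument of \<open>F\<close> makes the same predicate
  express that rows go to columns, or that columns go to rows or to columns.\<close>

definition row_lines :: "nat \<Rightarrow> ((nat \<Rightarrow> nat \<Rightarrow> 'a::field) \<Rightarrow> nat \<Rightarrow> nat \<Rightarrow> 'a) \<Rightarrow> (nat \<Rightarrow> nat) \<Rightarrow> bool" where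
  "row_lines n F \<sigma> \<longleftrightarrow> \<sigma> \<in> {..<n} \<rightarrow> {..<n} \<and> inj_on \<sigma> {..<n} \<and> (\<forall>i<n. \<forall>f\<in>row_mats n i. in_row (\<sigma> i) (F f))"

lemma row_lines_choose:
  assumes F: "preserver n F"
    and ex: "\<And>i. i < n \<Longrightarrow> \<exists>a. \<forall>f\<in>row_mats n i. in_row a (F f)"
    and inj: "\<And>i k a. i < n \<Longrightarrow> k < n \<Longrightarrow> i \<noteq> k \<Longrightarrow> \<forall>f\<in>row_mats n i. in_row a (F f) \<Longrightarrow>
      \<forall>f\<in>row_mats n k. in_row a (F f) \<Longrightarrow> False"
  shows "\<exists>\<sigma>. row_lines n F \<sigma>"
proof -
  from ex obtain \<sigma> where \<sigma>: "\<And>i. i < n \<Longrightarrow> \<forall>f\<in>row_mats n i. in_row (\<sigma> i) (F f)" by metis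
  have "inj_on \<sigma> {..<n}"
    by (rule inj_onI) (metis inj \<sigma> lessThan_iff)
  moreover have "\<sigma> \<in> {..<n} \<rightarrow> {..<n}" using preserver_row_index_less[OF F] \<sigma> by auto
  ultimately show ?thesis using \<sigma> unfolding row_lines_def by blast
qed

text \<open>If the image of some row lies in no single row, it lies in a column, and
  \<open>mix\<close> then forces every other row into a column.\<close>

lemma row_lines_or_col_lines:
  assumes F: "preserver n F"
    and ex: "\<And>i. i < n \<Longrightarrow> (\<exists>a. \<forall>f\<in>row_mats n i. in_row a (F f)) \<or> (\<exists>b. \<forall>f\<in>row_mats n i. in_row b (tr (F f)))"
    and injr: "\<And>i k a. i < n \<Longrightarrow> k < n \<Longrightarrow> i \<noteq> k \<Longrightarrow> \<forall>f\<in>row_mats n i. in_row a (F f) \<Longrightarrow>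
      \<forall>f\<in>row_mats n k. in_row a (F f) \<Longrightarrow> False"
    and injc: "\<And>i k a. i < n \<Longrightarrow> k < n \<Longrightarrow> i \<noteq> k \<Longrightarrow> \<forall>f\<in>row_mats n i. in_row a (tr (F f)) \<Longrightarrow>
      \<forall>f\<in>row_mats n k. in_row a (tr (F f)) \<Longrightarrow> False"
    and mix: "\<And>i k a b. i < n \<Longrightarrow> k < n \<Longrightarrow> i \<noteq> k \<Longrightarrow> \<forall>f\<in>row_mats n i. in_row a (F f) \<Longrightarrow>
      \<forall>f\<in>row_mats n k. in_row b (tr (F f)) \<Longrightarrow> False"
  shows "\<exists>\<sigma>. row_lines n F \<sigma> \<or> row_lines n (\<lambda>f. tr (F f)) \<sigma>"
proof (cases "\<forall>i<n. \<exists>a. \<forall>f\<in>row_mats n i. in_row a (F f)")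
  case True
  hence "\<exists>\<sigma>. row_lines n F \<sigma>" by (intro row_lines_choose[OF F]) (blast, use injr in blast)
  thus ?thesis by blast
next
  case False
  then obtain i where i: "i < n" "\<not> (\<exists>a. \<forall>f\<in>row_mats n i. in_row a (F f))" by blast
  with ex have "\<exists>b. \<forall>f\<in>row_mats n i. in_row b (tr (F f))" by blast
  with mix i(1) ex have "\<exists>b. \<forall>f\<in>row_mats n k. in_row b (tr (F f))" if "k < n" for k
    using that by (cases "k = i") metis+
  hence "\<exists>\<sigma>. row_lines n (\<lambda>f. tr (F f)) \<sigma>"
    by (intro row_lines_choose[OF preserver_tr_comp[OF F]]) (blast, use injc in blast)
  thus ?thesis by blast
qed

section \<open>Surjective maps: counting dimensions\<close>

global_interpretation fs: vector_space "\<lambda>(c::'a::field) (f::nat \<Rightarrow> nat \<Rightarrow> 'a) i j. c * f i j"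
  by standard (auto simp: fun_eq_iff algebra_simps)

lemma single_one_inject [simp]:
  "single i j (1::'a::zero_neq_one) = single i' j' 1 \<longleftrightarrow> i = i' \<and> j = j'"
proof
  assume "single i j (1::'a) = single i' j' 1"
  from fun_cong[OF fun_cong[OF this], of i j] show "i = i' \<and> j = j'"
    by (auto simp: single_apply split: if_splits)
qed simp

lemma inj_single: "inj_on (\<lambda>(p, q). single p q (1::'a::zero_neq_one)) A"
  by (auto intro: inj_onI)

lemma independent_singles: "fs.independent ((\<lambda>(p, q). single p q (1::'a::field)) ` (P \<times> Q))"
  unfolding fs.independent_explicit_module
proof (intro allI impI)
  fix t and u :: "(nat \<Rightarrow> nat \<Rightarrow> 'a) \<Rightarrow> 'a" and v
  assume t: "finite t" "t \<subseteq> (\<lambda>(p, q). single p q (1::'a)) ` (P \<times> Q)"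
    and s: "(\<Sum>v\<in>t. (\<lambda>i j. u v * v i j)) = 0" and v: "v \<in> t"
  from v t obtain p q where pq: "v = single p q 1" by fastforce
  have "u w * w p q = (if w = v then u v else 0)" if "w \<in> t" for w
  proof -
    from that t obtain p' q' where "w = single p' q' 1" by fastforce
    thus ?thesis using pq by (cases "p = p' \<and> q = q'") (auto simp: single_apply)
  qed
  hence "(\<Sum>w\<in>t. u w * w p q) = u v" using t v by simp
  thus "u v = 0" using fun_cong[OF fun_cong[OF s], of p q] by (simp add: sum_fun2_apply)
qed

text \<open>The row images together span \<open>fmat n\<close>, which contains \<open>n * n\<close>
  independent units, while the \<open>n\<close> spanning sets have at most \<open>n\<close> elements
  each. This leaves no slack: no set is smaller than \<open>n\<close> and no two sets meet.\<close>

lemma surj_spanning_sets_disjoint: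
  fixes F :: "(nat \<Rightarrow> nat \<Rightarrow> 'a::field) \<Rightarrow> nat \<Rightarrow> nat \<Rightarrow> 'a"
  assumes F: "preserver n F" and surj: "F ` fmat n = fmat n"
    and T: "\<And>m. m < n \<Longrightarrow> finite (T m) \<and> card (T m) \<le> n \<and> F ` row_mats n m \<subseteq> fs.span (T m)"
    and i: "i < n"
  shows "card (T i) = n" and "k < n \<Longrightarrow> k \<noteq> i \<Longrightarrow> T i \<inter> T k = {}"
proof -
  let ?U = "(\<lambda>(p, q). single p q (1::'a)) ` ({..<n} \<times> {..<n})"
  let ?T = "\<Union>m<n. T m"
  have span: "fmat n \<subseteq> fs.span ?T"
  proof
    fix f :: "nat \<Rightarrow> nat \<Rightarrow> 'a" assume "f \<in> fmat n"
    with surj obtain g where g: "g \<in> fmat n" "f = F g" by blast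
    define h where "h m = (\<lambda>p q. if p = m then g p q else 0)" for m
    have h: "h m \<in> row_mats n m" for m
      using g by (auto simp: h_def row_mats_def fmat_def in_row_def)
    have "g = (\<Sum>m<n. h m)"
      using g(1) by (auto simp: fun_eq_iff sum_fun2_apply h_def fmat_def)
    hence "f = (\<Sum>m<n. F (h m))"
      using g preserver_sum[OF F, of "{..<n}" h] h rows_fmat by auto
    moreover have "F (h m) \<in> fs.span ?T" if "m < n" for m
    proof -
      have "F (h m) \<in> fs.span (T m)" using T[OF that] h by blast
      thus ?thesis using fs.span_mono[of "T m" ?T] that by blast
    qed
    ultimately show "f \<in> fs.span ?T" by (auto intro: fs.span_sum)
  qed
  have "finite ?T" using T by auto
  moreover have "?U \<subseteq> fs.span ?T" using span by auto
  ultimately have "card ?U \<le> card ?T"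
    using fs.independent_span_bound independent_singles by blast
  hence big: "n * n \<le> card ?T"
    by (simp add: card_image[OF inj_single] card_cartesian_product)
  let ?s = "\<Sum>m\<in>{..<n} - {i}. card (T m)"
  have split: "?T = (\<Union>m\<in>{..<n} - {i}. T m) \<union> T i" using i by auto
  have le: "card (\<Union>m\<in>{..<n} - {i}. T m) \<le> ?s" by (intro card_UN_le) auto
  have "?s \<le> (\<Sum>m\<in>{..<n} - {i}. n)" using T by (intro sum_mono) auto
  hence s: "?s \<le> n * n - n" using i by (simp add: algebra_simps)
  have nn: "n \<le> n * n" by simp
  have "card ?T \<le> ?s + card (T i)" unfolding split using add_right_mono[OF le] by (rule order_trans[OF card_Un_le])
  thus "card (T i) = n" using big s T[OF i] nn by linarith
  show "T i \<inter> T k = {}" if k: "k < n" "k \<noteq> i"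
  proof (rule ccontr)
    assume ne: "T i \<inter> T k \<noteq> {}"
    \<comment> \<open>The elements of \<open>T k\<close> may be dropped from \<open>T i\<close>
      without changing the union, since \<open>k\<close> is among the remaining indices.\<close>
    have "?T = (\<Union>m\<in>{..<n} - {i}. T m) \<union> (T i - T k)" using i k by auto
    also have "card \<dots> \<le> ?s + card (T i - T k)"
      using add_right_mono[OF le] by (rule order_trans[OF card_Un_le])
    finally have "card ?T \<le> ?s + card (T i - T k)" .
    moreover have "card (T i - T k) < card (T i)" using ne T[OF i] by (intro psubset_card_mono) auto
    ultimately show False using big s T[OF i] nn by linarith
  qed
qed

lemma in_row_in_span:
  fixes f :: "nat \<Rightarrow> nat \<Rightarrow> 'a::field"
  assumes "in_row a f" "f \<in> fmat n"
  shows "f \<in> fs.span ((\<lambda>(p, q). single p q 1) ` ({a} \<times> {..<n}))"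
proof -
  have "f = (\<Sum>q<n. (\<lambda>i j. f a q * single a q 1 i j))"
  proof (intro ext)
    fix i j
    show "f i j = (\<Sum>q<n. (\<lambda>i j. f a q * single a q 1 i j)) i j"
      using assms by (cases "i = a"; cases "j < n")
        (auto simp: sum_fun2_apply single_apply in_row_def fmat_def if_distrib[of "(*) _"] sum.delta cong: if_cong)
  qed
  moreover have "(\<Sum>q<n. (\<lambda>i j. f a q * single a q 1 i j))
    \<in> fs.span ((\<lambda>(p, q). single p q 1) ` ({a} \<times> {..<n}))"
    by (intro fs.span_sum fs.span_scale fs.span_base) auto
  ultimately show ?thesis by simp
qed

lemma in_col_in_span:
  fixes f :: "nat \<Rightarrow> nat \<Rightarrow> 'a::field"
  assumes "in_row a (tr f)" "f \<in> fmat n"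
  shows "f \<in> fs.span ((\<lambda>(p, q). single p q 1) ` ({..<n} \<times> {a}))"
proof -
  have "f = (\<Sum>p<n. (\<lambda>i j. f p a * single p a 1 i j))"
  proof (intro ext)
    fix i j
    show "f i j = (\<Sum>p<n. (\<lambda>i j. f p a * single p a 1 i j)) i j"
      using assms by (cases "j = a"; cases "i < n")
        (auto simp: sum_fun2_apply single_apply in_row_def fmat_def if_distrib[of "(*) _"] sum.delta cong: if_cong)
  qed
  moreover have "(\<Sum>p<n. (\<lambda>i j. f p a * single p a 1 i j))
    \<in> fs.span ((\<lambda>(p, q). single p q 1) ` ({..<n} \<times> {a}))"
    by (intro fs.span_sum fs.span_scale fs.span_base) auto
  ultimately show ?thesis by simp
qed

text \<open>The candidates for spanning sets are the units of a row, the units of a column, or two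
  functions. As \<open>n > 2\<close>, the count excludes the last kind. Disjointness excludes equal
  lines, and also a row together with a column, since these share a unit.\<close>

lemma surj_row_or_col_lines:
  fixes F :: "(nat \<Rightarrow> nat \<Rightarrow> 'a::field) \<Rightarrow> nat \<Rightarrow> nat \<Rightarrow> 'a"
  assumes two: "(2::'a) \<noteq> 0" and n: "n \<ge> 3"
    and F: "preserver n F" and surj: "F ` fmat n = fmat n"
  shows "\<exists>\<sigma>. row_lines n F \<sigma> \<or> row_lines n (\<lambda>f. tr (F f)) \<sigma>"
proof -
  define ok where "ok X m \<longleftrightarrow> finite X \<and> card X \<le> n \<and> F ` row_mats n m \<subseteq> fs.span X" for X m
  define R where "R a = (\<lambda>(p, q). single p q (1::'a)) ` ({a} \<times> {..<n})" for a
  define C where "C a = (\<lambda>(p, q). single p q (1::'a)) ` ({..<n} \<times> {a})" for a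
  have R: "ok (R a) i" if "\<forall>f\<in>row_mats n i. in_row a (F f)" for a i
    unfolding ok_def R_def using that preserver_fmat[OF F]
    by (auto simp: card_image[OF inj_single] card_cartesian_product intro!: in_row_in_span dest: rows_fmat)
  have C: "ok (C a) i" if "\<forall>f\<in>row_mats n i. in_row a (tr (F f))" for a i
    unfolding ok_def C_def using that preserver_fmat[OF F]
    by (auto simp: card_image[OF inj_single] card_cartesian_product intro!: in_col_in_span dest: rows_fmat)
  have two_spanD: "\<exists>X. ok X i \<and> card X < n" if ts: "two_span (F ` row_mats n i)" for i
  proof -
    from ts obtain u v where uv: "\<forall>f\<in>F ` row_mats n i. \<exists>\<alpha> \<beta>. \<forall>p q. f p q = \<alpha> * u p q + \<beta> * v p q"
      unfolding two_span_def by blast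
    have "f \<in> fs.span {u, v}" if "f \<in> F ` row_mats n i" for f
    proof -
      from uv that obtain \<alpha> \<beta> where "\<forall>p q. f p q = \<alpha> * u p q + \<beta> * v p q" by blast
      hence "f = (\<lambda>p q. \<alpha> * u p q) + (\<lambda>p q. \<beta> * v p q)" by (simp add: fun_eq_iff)
      moreover have "(\<lambda>p q. \<alpha> * u p q) + (\<lambda>p q. \<beta> * v p q) \<in> fs.span {u, v}"
        by (intro fs.span_add fs.span_scale fs.span_base) auto
      ultimately show ?thesis by (simp only:)
    qed
    moreover have "card {u, v} \<le> 2" by (simp add: card_insert_if)
    ultimately show ?thesis using n by (intro exI[of _ "{u, v}"]) (auto simp: ok_def)
  qed
  have "\<exists>X. ok X i" for i
    using preserver_rows_classify[OF two F, of i] R C two_spanD by metis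
  \<comment> \<open>\<open>T\<close> is an arbitrary choice; it is overwritten at \<open>i\<close>
    and \<open>k\<close> below, so that the counting lemma speaks about given sets \<open>X\<close>
    and \<open>Y\<close>.\<close>
  then obtain T where T: "\<And>m. ok (T m) m" by metis
  note disj = surj_spanning_sets_disjoint[OF F surj]
  have full: "card X = n" if "i < n" "ok X i" for i X
    using disj(1)[of "T(i := X)" i] T that by (simp add: ok_def)
  have clash: False if "i < n" "k < n" "i \<noteq> k" "ok X i" "ok Y k" "x \<in> X" "x \<in> Y" for i k X Y x
  proof -
    have "(T(i := X, k := Y)) i \<inter> (T(i := X, k := Y)) k = {}"
      using T that by (intro disj(2)) (auto simp: ok_def)
    thus False using that by auto
  qed
  have lines: "(\<exists>a. \<forall>f\<in>row_mats n i. in_row a (F f)) \<or> (\<exists>b. \<forall>f\<in>row_mats n i. in_row b (tr (F f)))"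
    if "i < n" for i
    using preserver_rows_classify[OF two F, of i] two_spanD[of i] full[OF that] by (metis less_irrefl)
  show ?thesis
  proof (rule row_lines_or_col_lines[OF F lines])
    fix i k a assume ik: "i < n" "k < n" "i \<noteq> k" "\<forall>f\<in>row_mats n i. in_row a (F f)"
      "\<forall>f\<in>row_mats n k. in_row a (F f)"
    have "single a 0 1 \<in> R a" using n by (auto simp: R_def)
    thus False using clash[OF ik(1-3) R[OF ik(4)] R[OF ik(5)]] by blast
  next
    fix i k a assume ik: "i < n" "k < n" "i \<noteq> k" "\<forall>f\<in>row_mats n i. in_row a (tr (F f))"
      "\<forall>f\<in>row_mats n k. in_row a (tr (F f))"
    have "single 0 a 1 \<in> C a" using n by (auto simp: C_def)
    thus False using clash[OF ik(1-3) C[OF ik(4)] C[OF ik(5)]] by blast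
  next
    fix i k a b assume ik: "i < n" "k < n" "i \<noteq> k" "\<forall>f\<in>row_mats n i. in_row a (F f)"
      "\<forall>f\<in>row_mats n k. in_row b (tr (F f))"
    have "a < n" using preserver_row_index_less[OF F ik(1,4)] .
    moreover have "b < n" using preserver_row_index_less[OF preserver_tr_comp[OF F] ik(2,5)] .
    ultimately have "single a b 1 \<in> R a" "single a b 1 \<in> C b" by (auto simp: R_def C_def)
    thus False using clash[OF ik(1-3) R[OF ik(4)] C[OF ik(5)]] by blast
  qed
qed

section \<open>Preservation in both directions: polar forms of the images of units\<close>

text \<open>The only consequence of preservation in both directions that the proof needs.\<close>

definition separating :: "nat \<Rightarrow> ((nat \<Rightarrow> nat \<Rightarrow> 'a::field) \<Rightarrow> nat \<Rightarrow> nat \<Rightarrow> 'a) \<Rightarrow> bool" where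
  "separating n F \<longleftrightarrow> (\<forall>i<n. \<forall>k<n. \<forall>j<n. \<forall>l<n. i \<noteq> k \<longrightarrow> j \<noteq> l \<longrightarrow> \<not> perm2_zero (F (single i j 1 + single k l 1)))"

text \<open>The block itself carries the only 2 by 2 subpermanent that is not trivially
  zero.\<close>

lemma perm2_zero_block:
  fixes x y z w :: "'a::field"
  assumes "i \<noteq> k" "j \<noteq> l" "x * w + y * z = 0"
  shows "perm2_zero (single i j x + single i l y + (single k j z + single k l w))"
  unfolding perm2_zero_def
proof (intro allI impI)
  fix i' k' j' l' :: nat assume ne: "i' \<noteq> k'" "j' \<noteq> l'"
  let ?f = "single i j x + single i l y + (single k j z + single k l w)"
  have 0: "?f p q = 0" if "p \<notin> {i, k} \<or> q \<notin> {j, l}" for p q using that by (auto simp: single_apply)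
  have f: "?f i j = x" "?f i l = y" "?f k j = z" "?f k l = w"
    using assms by (simp_all add: single_apply)
  consider "i' \<notin> {i, k}" | "k' \<notin> {i, k}" | "j' \<notin> {j, l}" | "l' \<notin> {j, l}"
    | "{i', k'} = {i, k}" "{j', l'} = {j, l}" using ne by auto
  thus "?f i' j' * ?f k' l' + ?f i' l' * ?f k' j' = 0"
  proof cases
    case 5
    have "z * y + w * x = 0" "w * x + z * y = 0" "y * z + x * w = 0" using assms(3) by (simp_all add: algebra_simps)
    moreover from 5 ne have "(i' = i \<and> k' = k \<or> i' = k \<and> k' = i) \<and> (j' = j \<and> l' = l \<or> j' = l \<and> l' = j)"
      by (auto simp: doubleton_eq_iff)
    ultimately show ?thesis using assms(3) f by (elim conjE disjE) (simp_all only:)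
  qed (simp_all only: 0 mult_zero_left mult_zero_right add_0 simp_thms)
qed

text \<open>The cross product of \<open>a\<close> and \<open>b\<close> provides the coefficients. If
  it is zero, \<open>a\<close> and \<open>b\<close> are parallel, and a nonzero vector orthogonal to
  both is written down directly.\<close>

lemma dependent3:
  fixes a b :: "nat \<Rightarrow> 'a::field"
  shows "\<exists>c0 c1 c2. (c0 \<noteq> 0 \<or> c1 \<noteq> 0 \<or> c2 \<noteq> 0) \<and> c0 * a 0 + c1 * a 1 + c2 * a 2 = 0
    \<and> c0 * b 0 + c1 * b 1 + c2 * b 2 = 0"
proof (cases "a 1 * b 2 - a 2 * b 1 = 0 \<and> a 2 * b 0 - a 0 * b 2 = 0 \<and> a 0 * b 1 - a 1 * b 0 = 0")
  case False
  thus ?thesis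
    by (intro exI[of _ "a 1 * b 2 - a 2 * b 1"] exI[of _ "a 2 * b 0 - a 0 * b 2"]
        exI[of _ "a 0 * b 1 - a 1 * b 0"]) (auto simp: algebra_simps)
next
  case True
  show ?thesis
  proof (cases "a 0 = 0")
    case a0: True
    show ?thesis
    proof (cases "b 0 = 0")
      case True
      thus ?thesis using a0 by (intro exI[of _ 1] exI[of _ 0]) simp
    next
      case False
      thus ?thesis using True a0
        by (intro exI[of _ "b 1"] exI[of _ "- b 0"] exI[of _ 0]) (auto simp: algebra_simps)
    qed
  next
    case False
    thus ?thesis using True
      by (intro exI[of _ "a 1"] exI[of _ "- a 0"] exI[of _ 0]) (auto simp: algebra_simps)
  qed
qed

text \<open>A span of two functions makes the images \<open>x 0\<close>, \<open>x 1\<close>,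
  \<open>x 2\<close> of units of row \<open>i\<close> dependent. Pairing the dependency with images
  \<open>y l\<close> of units of another row gives linear equations whose coefficients
  \<open>V m l\<close> form a symmetric matrix with zero diagonal. By \<open>separating\<close>, no
  off-diagonal entry vanishes on all blocks, and this forces the dependency to be trivial.\<close>

lemma separating_not_two_span:
  fixes F :: "(nat \<Rightarrow> nat \<Rightarrow> 'a::field) \<Rightarrow> nat \<Rightarrow> nat \<Rightarrow> 'a"
  assumes two: "(2::'a) \<noteq> 0" and n: "n \<ge> 3" and F: "preserver n F" and sep: "separating n F"
    and i: "i < n"
  shows "\<not> two_span (F ` row_mats n i)"
proof
  assume "two_span (F ` row_mats n i)"
  then obtain u v where uv: "\<forall>f\<in>F ` row_mats n i. \<exists>\<alpha> \<beta>. \<forall>p q. f p q = \<alpha> * u p q + \<beta> * v p q"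
    unfolding two_span_def by blast
  define x where "x m = F (single i m 1)" for m
  have "\<exists>\<alpha> \<beta>. \<forall>p q. x m p q = \<alpha> * u p q + \<beta> * v p q" if "m < n" for m
    using uv i that unfolding x_def by (intro uv[rule_format] imageI) simp
  then obtain \<alpha> \<beta> where ab: "\<And>m p q. m < n \<Longrightarrow> x m p q = \<alpha> m * u p q + \<beta> m * v p q" by metis
  obtain c0 c1 c2 where c: "c0 \<noteq> 0 \<or> c1 \<noteq> 0 \<or> c2 \<noteq> 0"
      "c0 * \<alpha> 0 + c1 * \<alpha> 1 + c2 * \<alpha> 2 = 0" "c0 * \<beta> 0 + c1 * \<beta> 1 + c2 * \<beta> 2 = 0"
    using dependent3[of \<alpha> \<beta>] by blast
  have dep: "c0 * x 0 p q + c1 * x 1 p q + c2 * x 2 p q = 0" for p q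
  proof -
    have "c0 * x 0 p q + c1 * x 1 p q + c2 * x 2 p q
      = (c0 * \<alpha> 0 + c1 * \<alpha> 1 + c2 * \<alpha> 2) * u p q + (c0 * \<beta> 0 + c1 * \<beta> 1 + c2 * \<beta> 2) * v p q"
      using n by (simp add: ab algebra_simps)
    thus ?thesis using c by simp
  qed
  define k where "k = (if i = 0 then 1 else 0 :: nat)"
  have k: "k < n" "k \<noteq> i" using n by (auto simp: k_def)
  define y where "y m = F (single k m 1)" for m
  \<comment> \<open>The polar form of \<open>x m\<close> and \<open>y l\<close> on rows
    \<open>p\<close>, \<open>r\<close> and columns \<open>q\<close>, \<open>s\<close>.\<close>
  define V where "V m l p r q s = x m p q * y l r s + x m r s * y l p q + x m p s * y l r q + x m r q * y l p s"
    for m l p r q s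
  have perm2_zero: "perm2_zero (x m)" "perm2_zero (y m)" if "m < n" for m
    unfolding x_def y_def using i k that by (auto intro!: preserver_perm2_zero[OF F])
  \<comment> \<open>The units at \<open>(i, m)\<close> and \<open>(k, m)\<close> lie in one
    column.\<close>
  have V0: "V m m p r q s = 0" if "m < n" "p \<noteq> r" "q \<noteq> s" for m p r q s
  proof -
    have "perm2_zero (tr (single i m 1 + single k m (1::'a)))"
      by (rule perm2_zero_in_row[of m]) (simp add: in_row_def single_apply)
    hence "perm2_zero (F (single i m 1 + single k m 1))"
      using i k that by (intro preserver_perm2_zero[OF F]) (auto intro!: fmat_add)
    hence "perm2_zero (x m + y m)"
      using i k that by (simp add: x_def y_def preserver_add[OF F])
    thus ?thesis using perm2_zero_polar[OF perm2_zero(1) perm2_zero(2)] that by (simp add: V_def)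
  qed
  \<comment> \<open>The block with rows \<open>(1, 1)\<close> and \<open>(1, -1)\<close> has
    subpermanent zero, so the images \<open>x m + x l\<close> and \<open>y m - y l\<close> of its
    rows are orthogonal. Expanding leaves \<open>V l m - V m l\<close> besides the diagonal values,
    which vanish.\<close>
  have Vsym: "V m l p r q s = V l m p r q s" if "m < n" "l < n" "m \<noteq> l" "p \<noteq> r" "q \<noteq> s" for m l p r q s
  proof -
    have neg: "F (single k l (-1)) = - y l"
    proof -
      have "F (single k l (-1)) + y l = F (single k l (-1) + single k l 1)"
        unfolding y_def using k that by (intro preserver_add[OF F, symmetric]) simp_all
      also have "single k l (-1) + single k l (1::'a) = 0"
        by (simp flip: single_add)
      finally show ?thesis
        unfolding preserver_zero[OF F] by (rule eq_neg_iff_add_eq_0[THEN iffD2])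
    qed
    have 1: "F (single i m 1 + single i l 1) = x m + x l"
      using i that by (simp add: x_def preserver_add[OF F])
    have 2: "F (single k m 1 + single k l (-1)) = y m - y l"
      using k that by (simp add: preserver_add[OF F] neg) (simp add: y_def)
    have "perm2_zero (F (single i m 1 + single i l 1))"
      by (rule preserver_perm2_zero[OF F]) (use i that in \<open>auto intro!: rows_fmat[of _ n i] perm2_zero_rows[of _ n i] rows_add\<close>)
    moreover have "perm2_zero (F (single k m 1 + single k l (-1)))"
      by (rule preserver_perm2_zero[OF F]) (use k that in \<open>auto intro!: rows_fmat[of _ n k] perm2_zero_rows[of _ n k] rows_add\<close>)
    moreover have "perm2_zero (F (single i m 1 + single i l 1 + (single k m 1 + single k l (-1))))"
      by (rule preserver_perm2_zero[OF F]) (use i k that in \<open>auto intro!: fmat_add perm2_zero_block\<close>)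
    moreover have "F (single i m 1 + single i l 1 + (single k m 1 + single k l (-1))) = x m + x l + (y m - y l)"
      using i k that by (subst preserver_add[OF F]) (auto intro!: fmat_add simp: 1 2)
    ultimately have "perm2_zero (x m + x l)" "perm2_zero (y m - y l)" "perm2_zero (x m + x l + (y m - y l))"
      by (simp_all add: 1 2)
    from perm2_zero_polar[OF this that(4,5)] have "V m m p r q s + V l m p r q s - V m l p r q s - V l l p r q s = 0"
      by (simp add: V_def algebra_simps)
    thus ?thesis using V0 that by simp
  qed
  have Vnz: "\<exists>p r q s. p \<noteq> r \<and> q \<noteq> s \<and> V m l p r q s \<noteq> 0" if "m < n" "l < n" "m \<noteq> l" for m l
  proof (rule ccontr)
    assume no: "\<not> ?thesis"
    have "perm2_zero (x m + y l)"
      unfolding perm2_zero_def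
    proof (intro allI impI)
      fix p r q s :: nat assume pr: "p \<noteq> r" "q \<noteq> s"
      have V0: "V m l p r q s = 0" using no pr by blast
      have "(x m + y l) p q * (x m + y l) r s + (x m + y l) p s * (x m + y l) r q
        = V m l p r q s + (x m p q * x m r s + x m p s * x m r q) + (y l p q * y l r s + y l p s * y l r q)"
        by (simp add: V_def algebra_simps)
      thus "(x m + y l) p q * (x m + y l) r s + (x m + y l) p s * (x m + y l) r q = 0"
        using V0 perm2_zeroD[OF perm2_zero(1)[OF that(1)] pr] perm2_zeroD[OF perm2_zero(2)[OF that(2)] pr] by simp
    qed
    moreover have "F (single i m 1 + single k l 1) = x m + y l"
      using i k that by (simp add: x_def y_def preserver_add[OF F])
    ultimately show False using sep i k that unfolding separating_def by metis
  qed
  have lin: "c0 * V 0 l p r q s + c1 * V 1 l p r q s + c2 * V 2 l p r q s = 0" for l p r q s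
  proof -
    have "c0 * V 0 l p r q s + c1 * V 1 l p r q s + c2 * V 2 l p r q s
      = (c0 * x 0 p q + c1 * x 1 p q + c2 * x 2 p q) * y l r s
      + (c0 * x 0 r s + c1 * x 1 r s + c2 * x 2 r s) * y l p q
      + (c0 * x 0 p s + c1 * x 1 p s + c2 * x 2 p s) * y l r q
      + (c0 * x 0 r q + c1 * x 1 r q + c2 * x 2 r q) * y l p s"
      by (simp add: V_def algebra_simps)
    thus ?thesis by (simp only: dep) simp
  qed
  have N: "0 < n" "1 < n" "2 < n" using n by auto
  have eqs: "c1 * V 0 1 p r q s + c2 * V 0 2 p r q s = 0" "c0 * V 0 1 p r q s + c2 * V 1 2 p r q s = 0"
    "c0 * V 0 2 p r q s + c1 * V 1 2 p r q s = 0" if "p \<noteq> r" "q \<noteq> s" for p r q s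
    using lin[where l = 0 and p = p and r = r and q = q and s = s]
      lin[where l = 1 and p = p and r = r and q = q and s = s]
      lin[where l = 2 and p = p and r = r and q = q and s = s]
      V0[OF N(1) that] V0[OF N(2) that] V0[OF N(3) that]
      Vsym[OF N(1,2) _ that] Vsym[OF N(1,3) _ that] Vsym[OF N(2,3) _ that] by simp_all
  \<comment> \<open>Adding two of the equations and subtracting the third, each weighted by one of
    \<open>c0\<close>, \<open>c1\<close>, \<open>c2\<close>, leaves twice one product.\<close>
  have prods: "c1 * c2 * V 1 2 p r q s = 0" "c0 * c2 * V 0 2 p r q s = 0" "c0 * c1 * V 0 1 p r q s = 0"
    if "p \<noteq> r" "q \<noteq> s" for p r q s
  proof -
    have "2 * (c1 * c2 * V 1 2 p r q s)
      = c1 * (c0 * V 0 1 p r q s + c2 * V 1 2 p r q s) + c2 * (c0 * V 0 2 p r q s + c1 * V 1 2 p r q s)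
      - c0 * (c1 * V 0 1 p r q s + c2 * V 0 2 p r q s)" by (simp add: algebra_simps)
    thus "c1 * c2 * V 1 2 p r q s = 0" unfolding eqs[OF that] using two by simp
    have "2 * (c0 * c2 * V 0 2 p r q s)
      = c0 * (c1 * V 0 1 p r q s + c2 * V 0 2 p r q s) + c2 * (c0 * V 0 2 p r q s + c1 * V 1 2 p r q s)
      - c1 * (c0 * V 0 1 p r q s + c2 * V 1 2 p r q s)" by (simp add: algebra_simps)
    thus "c0 * c2 * V 0 2 p r q s = 0" unfolding eqs[OF that] using two by simp
    have "2 * (c0 * c1 * V 0 1 p r q s)
      = c0 * (c1 * V 0 1 p r q s + c2 * V 0 2 p r q s) + c1 * (c0 * V 0 1 p r q s + c2 * V 1 2 p r q s)
      - c2 * (c0 * V 0 2 p r q s + c1 * V 1 2 p r q s)" by (simp add: algebra_simps)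
    thus "c0 * c1 * V 0 1 p r q s = 0" unfolding eqs[OF that] using two by simp
  qed
  \<comment> \<open>The three values may be nonzero on different blocks; \<open>prods\<close> is
    available on each of them.\<close>
  obtain p r q s where v01: "p \<noteq> r" "q \<noteq> s" "V 0 1 p r q s \<noteq> 0"
    using Vnz[OF N(1,2)] by auto
  obtain p' r' q' s' where v02: "p' \<noteq> r'" "q' \<noteq> s'" "V 0 2 p' r' q' s' \<noteq> 0"
    using Vnz[OF N(1,3)] by auto
  obtain p'' r'' q'' s'' where v12: "p'' \<noteq> r''" "q'' \<noteq> s''" "V 1 2 p'' r'' q'' s'' \<noteq> 0"
    using Vnz[OF N(2,3)] by auto
  have "c1 * c2 = 0" "c0 * c2 = 0" "c0 * c1 = 0"
    using prods(1)[OF v12(1,2)] prods(2)[OF v02(1,2)] prods(3)[OF v01(1,2)] v01 v02 v12 by simp_all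
  \<comment> \<open>At most one coefficient is nonzero, and an equation on a block where its factor
    is nonzero removes it.\<close>
  hence "(c1 = 0 \<and> c2 = 0) \<or> (c0 = 0 \<and> c2 = 0) \<or> (c0 = 0 \<and> c1 = 0)" by auto
  thus False
    using c(1) eqs(1,2)[OF v01(1,2)] eqs(2)[OF v12(1,2)] v01(3) v12(3) by auto
qed

text \<open>Two rows sent into the same line would put the image of a sum of units from different
  rows and columns into one line, against \<open>separating\<close>. The mixed case compares three
  such sums.\<close>

lemma separating_row_or_col_lines:
  fixes F :: "(nat \<Rightarrow> nat \<Rightarrow> 'a::field) \<Rightarrow> nat \<Rightarrow> nat \<Rightarrow> 'a"
  assumes two: "(2::'a) \<noteq> 0" and n: "n \<ge> 3" and F: "preserver n F" and sep: "separating n F"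
  shows "\<exists>\<sigma>. row_lines n F \<sigma> \<or> row_lines n (\<lambda>f. tr (F f)) \<sigma>"
proof -
  have ng: "\<not> perm2_zero (F (single i j 1) + F (single k l 1))" if "i < n" "k < n" "j < n" "l < n" "i \<noteq> k" "j \<noteq> l" for i j k l
    using sep that unfolding separating_def by (metis preserver_add[OF F] single_in_fmat)
  show ?thesis
  proof (rule row_lines_or_col_lines[OF F])
    fix i assume "i < n"
    thus "(\<exists>a. \<forall>f\<in>row_mats n i. in_row a (F f)) \<or> (\<exists>b. \<forall>f\<in>row_mats n i. in_row b (tr (F f)))"
      using preserver_rows_classify[OF two F, of i] separating_not_two_span[OF two n F sep] by blast
  next
    fix i k a assume ik: "i < n" "k < n" "i \<noteq> k" "\<forall>f\<in>row_mats n i. in_row a (F f)"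
      "\<forall>f\<in>row_mats n k. in_row a (F f)"
    hence "in_row a (F (single i 0 1) + F (single k 1 1))" using n by (intro in_row_add) auto
    hence "perm2_zero (F (single i 0 1) + F (single k 1 1))" by (rule perm2_zero_in_row)
    thus False using ng ik n by simp
  next
    fix i k a assume ik: "i < n" "k < n" "i \<noteq> k" "\<forall>f\<in>row_mats n i. in_row a (tr (F f))"
      "\<forall>f\<in>row_mats n k. in_row a (tr (F f))"
    hence "in_row a (tr (F (single i 0 1) + F (single k 1 1)))" using n by (simp add: tr_add in_row_add)
    hence "perm2_zero (F (single i 0 1) + F (single k 1 1))" using perm2_zero_in_row perm2_zero_tr by blast
    thus False using ng ik n by simp
  next
    fix i k a b assume ik: "i < n" "k < n" "i \<noteq> k" "\<forall>f\<in>row_mats n i. in_row a (F f)"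
      "\<forall>f\<in>row_mats n k. in_row b (tr (F f))"
    define x where "x m = F (single i m 1)" for m
    define y where "y m = F (single k m 1)" for m
    have x: "x m p q = 0" if "m < n" "p \<noteq> a" for m p q
      using ik that unfolding x_def in_row_def by simp
    have y: "y m p q = 0" if "m < n" "q \<noteq> b" for m p q
      using ik that unfolding y_def in_row_def by simp
    have "\<not> perm2_zero (x 0 + y 1)" "\<not> perm2_zero (x 1 + y 0)"
      unfolding x_def y_def using ng ik n by simp_all
    hence "\<not> in_row b (tr (x 0 + y 1))" "\<not> in_row a (x 1 + y 0)"
      using perm2_zero_in_row perm2_zero_tr by blast+
    \<comment> \<open>As \<open>x 0 + y 1\<close> is not confined to column \<open>b\<close>,
      \<open>x 0\<close> has a nonzero entry in row \<open>a\<close> off that column; symmetrically,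
      \<open>y 0\<close> has one in column \<open>b\<close> off row \<open>a\<close>.\<close>
    then obtain q p q' p' where "q \<noteq> b" "x 0 p' q + y 1 p' q \<noteq> 0" "p \<noteq> a" "x 1 p q' + y 0 p q' \<noteq> 0"
      unfolding in_row_def by auto
    moreover from this have "p' = a" "q' = b" using x[of 0 p' q] y[of 1 q p'] x[of 1 p q'] y[of 0 q' p] n by auto
    ultimately have "q \<noteq> b" "x 0 a q \<noteq> 0" "p \<noteq> a" "y 0 p b \<noteq> 0"
      using y[of 1 q a] x[of 1 p b] n by auto
    moreover have "perm2_zero (x 0 + y 0)"
    proof -
      have "perm2_zero (tr (single i 0 1 + single k 0 (1::'a)))"
        by (rule perm2_zero_in_row[of 0]) (simp add: in_row_def single_apply)
      hence "perm2_zero (F (single i 0 1 + single k 0 1))"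
        using ik n by (intro preserver_perm2_zero[OF F]) (auto intro!: fmat_add)
      thus ?thesis
        using ik n by (simp add: x_def y_def preserver_add[OF F])
    qed
    \<comment> \<open>The subpermanent of \<open>x 0 + y 0\<close> on rows \<open>a\<close>,
      \<open>p\<close> and columns \<open>q\<close>, \<open>b\<close> reduces to the product of
      these two entries, because the entry at \<open>(p, q)\<close> is zero.\<close>
    ultimately show False
      using perm2_zeroD[of "x 0 + y 0" a p q b] x[of 0 p q] y[of 0 q p] y[of 0 q a] x[of 0 p b] n by simp
  qed
qed

section \<open>Rows and columns together\<close>

text \<open>The image of the unit at \<open>(i, j)\<close> is nonzero and lies in row
  \<open>\<sigma> i\<close> and in row \<open>\<rho> j\<close>. Hence all these indices coincide,
  against injectivity.\<close>

lemma row_lines_clash: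
  assumes F: "preserver n F" and n: "n \<ge> 2"
    and \<sigma>: "row_lines n F \<sigma>" and \<rho>: "row_lines n (\<lambda>f. F (tr f)) \<rho>"
  shows False
proof -
  have eq: "\<sigma> i = \<rho> j" if "i < n" "j < n" for i j
  proof -
    let ?f = "F (single i j 1)"
    have "?f \<noteq> 0" using that by (intro preserver_nonzero[OF F]) simp_all
    then obtain p q where "?f p q \<noteq> 0" by (auto simp: fun_eq_iff)
    moreover have "in_row (\<sigma> i) ?f" using \<sigma> that unfolding row_lines_def by simp
    moreover have "in_row (\<rho> j) (F (tr (single j i 1)))"
      using \<rho> that unfolding row_lines_def by (metis single_in_rows)
    hence "in_row (\<rho> j) ?f" by simp
    ultimately show ?thesis unfolding in_row_def by metis
  qed
  have "\<sigma> 0 = \<sigma> 1" using eq[of 0 0] eq[of 1 0] n by simp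
  thus False using \<sigma> n inj_onD[of \<sigma> "{..<n}" 0 1] unfolding row_lines_def by auto
qed

text \<open>Joins the two alternatives in a form that persists when the argument is transposed, so
  that columns can be treated like rows.\<close>

definition rigid :: "nat \<Rightarrow> ((nat \<Rightarrow> nat \<Rightarrow> 'a::field) \<Rightarrow> nat \<Rightarrow> nat \<Rightarrow> 'a) \<Rightarrow> bool" where
  "rigid n F \<longleftrightarrow> F ` fmat n = fmat n \<or> separating n F"

lemma rigid_comp_tr: "rigid n F \<Longrightarrow> rigid n (\<lambda>f. F (tr f))"
  unfolding rigid_def
proof (elim disjE)
  have "tr ` fmat n = fmat n"
    by (auto intro!: image_eqI[of _ tr "tr _"])
  moreover assume "F ` fmat n = fmat n"
  ultimately have "(\<lambda>f. F (tr f)) ` fmat n = fmat n" by (metis image_image)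
  thus "(\<lambda>f. F (tr f)) ` fmat n = fmat n \<or> separating n (\<lambda>f. F (tr f))" ..
next
  assume "separating n F"
  hence "separating n (\<lambda>f. F (tr f))" by (auto simp: separating_def tr_add)
  thus "(\<lambda>f. F (tr f)) ` fmat n = fmat n \<or> separating n (\<lambda>f. F (tr f))" ..
qed

text \<open>Of the four combinations, \<open>row_lines_clash\<close> removes the two in which rows
  and columns go to parallel lines. The remaining ones lead to the form without and the form with
  transposition.\<close>

lemma rigid_rows_and_cols:
  fixes F :: "(nat \<Rightarrow> nat \<Rightarrow> 'a::field) \<Rightarrow> nat \<Rightarrow> nat \<Rightarrow> 'a"
  assumes two: "(2::'a) \<noteq> 0" and n: "n \<ge> 3" and F: "preserver n F" and rigid: "rigid n F"
  obtains \<sigma> \<tau> where "row_lines n F \<sigma>" "row_lines n (\<lambda>f. tr (F (tr f))) \<tau>"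
  | \<sigma> \<tau> where "row_lines n (\<lambda>f. tr (F f)) \<sigma>" "row_lines n (\<lambda>f. F (tr f)) \<tau>"
proof -
  have lines: "\<exists>\<sigma>. row_lines n G \<sigma> \<or> row_lines n (\<lambda>f. tr (G f)) \<sigma>"
    if "preserver n G" "rigid n G" for G :: "(nat \<Rightarrow> nat \<Rightarrow> 'a) \<Rightarrow> nat \<Rightarrow> nat \<Rightarrow> 'a"
    using that(2) surj_row_or_col_lines[OF two n that(1)] separating_row_or_col_lines[OF two n that(1)]
    unfolding rigid_def by blast
  have n2: "n \<ge> 2" using n by simp
  obtain \<sigma> where \<sigma>: "row_lines n F \<sigma> \<or> row_lines n (\<lambda>f. tr (F f)) \<sigma>"
    using lines[OF F rigid] by blast
  obtain \<tau> where \<tau>: "row_lines n (\<lambda>f. F (tr f)) \<tau> \<or> row_lines n (\<lambda>f. tr (F (tr f))) \<tau>"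
    using lines[OF preserver_comp_tr[OF F] rigid_comp_tr[OF rigid]] by blast
  show ?thesis
    using \<sigma> \<tau> row_lines_clash[OF F n2] row_lines_clash[OF preserver_tr_comp[OF F] n2] that by blast
qed

section \<open>The entry maps as multiples of one field endomorphism\<close>

text \<open>Blocks with rows \<open>(x, x)\<close>, \<open>(1, 1)\<close> show that
  \<open>g i j x / g i j 1\<close> does not depend on the column, those with rows
  \<open>(x, 1)\<close>, \<open>(x, 1)\<close> that it does not depend on the row. The block of ones
  splits \<open>g i j 1\<close> into \<open>d i * e j\<close>, and the block with rows
  \<open>(x, x * y)\<close>, \<open>(1, y)\<close> yields multiplicativity.\<close>

lemma block_multiplicative_factor:
  fixes g :: "nat \<Rightarrow> nat \<Rightarrow> 'a::field \<Rightarrow> 'a"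
  assumes n: "n \<ge> 2"
    and add: "\<And>i j x y. i < n \<Longrightarrow> j < n \<Longrightarrow> g i j (x + y) = g i j x + g i j y"
    and nz: "\<And>i j x. i < n \<Longrightarrow> j < n \<Longrightarrow> x \<noteq> 0 \<Longrightarrow> g i j x \<noteq> 0"
    and block: "\<And>i k j l x y z w. i < n \<Longrightarrow> k < n \<Longrightarrow> j < n \<Longrightarrow> l < n \<Longrightarrow> i \<noteq> k \<Longrightarrow> j \<noteq> l \<Longrightarrow>
      x * w + y * z = 0 \<Longrightarrow> g i j x * g k l w + g i l y * g k j z = 0"
  obtains \<phi> d e where "field_endomorphism \<phi>" "\<phi> 1 = 1"
    "\<And>i. i < n \<Longrightarrow> d i \<noteq> 0" "\<And>j. j < n \<Longrightarrow> e j \<noteq> 0"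
    "\<And>i j x. i < n \<Longrightarrow> j < n \<Longrightarrow> g i j x = d i * \<phi> x * e j"
proof -
  have N: "0 < n" "1 < n" using n by auto
  have g0: "g i j 0 = 0" if "i < n" "j < n" for i j using add[OF that, of 0 0] by (metis add_0 add_cancel_right_right)
  have neg: "g i j (- x) = - g i j x" if "i < n" "j < n" for i j x
    using add[OF that, of "- x" x] g0[OF that] by (simp add: eq_neg_iff_add_eq_0)
  \<comment> \<open>Replacing \<open>y\<close> by \<open>- y\<close> turns vanishing subpermanents
    into vanishing determinants.\<close>
  have R: "g i j x * g k l w = g i l y * g k j z"
    if "i < n" "k < n" "j < n" "l < n" "i \<noteq> k" "j \<noteq> l" "x * w = y * z" for i k j l x y z w
    using block[OF that(1-6), of x w "- y" z] that neg by simp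
  \<comment> \<open>Normalising at position \<open>(0, 0)\<close> gives \<open>\<phi> 1 = 1\<close>
    and recovers \<open>g i j 1\<close> from row 0 and column 0.\<close>
  define \<phi> where "\<phi> x = g 0 0 x / g 0 0 1" for x
  define d where "d i = g i 0 1" for i
  define e where "e j = g 0 j 1 / g 0 0 1" for j
  have other: "\<exists>k<n. k \<noteq> i" for i using N by (metis zero_neq_one)
  have row: "g i j x * g i l 1 = g i l x * g i j 1" if ij: "i < n" "j < n" "l < n" for i j l x
  proof (cases "j = l")
    case False
    obtain k where k: "k < n" "k \<noteq> i" using other by blast
    have 1: "g i j x * g k l 1 = g i l x * g k j 1" "g i j 1 * g k l 1 = g i l 1 * g k j 1"
      using R[of i k j l x 1 x 1] R[of i k j l 1 1 1 1] k ij False by auto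
    have "g k l 1 * (g i j x * g i l 1) = g i l x * (g i l 1 * g k j 1)"
      using 1(1) by (simp add: algebra_simps)
    also have "\<dots> = g k l 1 * (g i l x * g i j 1)" unfolding 1(2)[symmetric] by simp
    finally show ?thesis using nz[OF k(1) ij(3), of 1] by simp
  qed simp
  have col: "g i j x * g k j 1 = g k j x * g i j 1" if ij: "i < n" "j < n" "k < n" for i j k x
  proof (cases "i = k")
    case False
    obtain l where l: "l < n" "l \<noteq> j" using other by blast
    have 1: "g i j x * g k l 1 = g i l 1 * g k j x" "g i j 1 * g k l 1 = g i l 1 * g k j 1"
      using R[of i k j l x 1 1 x] R[of i k j l 1 1 1 1] l ij False by auto
    have "g k l 1 * (g i j x * g k j 1) = g k j x * (g i l 1 * g k j 1)"
      using 1(1) by (simp add: algebra_simps)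
    also have "\<dots> = g k l 1 * (g k j x * g i j 1)" unfolding 1(2)[symmetric] by simp
    finally show ?thesis using nz[OF ij(3) l(1), of 1] by simp
  qed simp
  have one: "g i j 1 \<noteq> 0" if "i < n" "j < n" for i j using nz that by simp
  have phi: "g i j x = \<phi> x * g i j 1" if ij: "i < n" "j < n" for i j x
  proof -
    have "g i j x = g i 0 x / g i 0 1 * g i j 1"
      using row[OF ij N(1), of x] one[OF ij(1) N(1)] by (simp add: field_simps)
    also have "g i 0 x / g i 0 1 = \<phi> x"
      using col[OF ij(1) N(1) N(1), of x] one[OF ij(1) N(1)] one[OF N(1) N(1)]
      by (simp add: field_simps \<phi>_def)
    finally show ?thesis .
  qed
  have de: "g i j 1 = d i * e j" if ij: "i < n" "j < n" for i j
  proof (cases "i = 0 \<or> j = 0")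
    case False
    thus ?thesis using R[of i 0 j 0 1 1 1 1] ij N one[OF N(1) N(1)] by (simp add: d_def e_def field_simps)
  qed (use one[OF N(1) N(1)] in \<open>auto simp: d_def e_def\<close>)
  have mult: "\<phi> (x * y) = \<phi> x * \<phi> y" for x y
  proof -
    have "g 0 0 x * g 1 1 y = g 0 1 (x * y) * g 1 0 1" "g 0 0 1 * g 1 1 1 = g 0 1 1 * g 1 0 1"
      using R[of 0 1 0 1 x y "x * y" 1] R[of 0 1 0 1 1 1 1 1] N by auto
    hence "\<phi> x * \<phi> y * (g 0 1 1 * g 1 0 1) = \<phi> (x * y) * (g 0 1 1 * g 1 0 1)"
      using phi[OF N(1) N(1), of x] phi[OF N(2) N(2), of y] phi[OF N(1) N(2), of "x * y"]
      by (metis (no_types, lifting) mult.assoc mult.left_commute)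
    thus ?thesis using one N by simp
  qed
  have "\<phi> (x + y) = \<phi> x + \<phi> y" for x y
    using add[OF N(1) N(1)] by (simp add: \<phi>_def add_divide_distrib)
  with mult have "field_endomorphism \<phi>" unfolding field_endomorphism_def by blast
  moreover have "\<phi> 1 = 1" using one N by (simp add: \<phi>_def)
  moreover have "d i \<noteq> 0" "e i \<noteq> 0" if "i < n" for i using one N that by (simp_all add: d_def e_def)
  moreover have "g i j x = d i * \<phi> x * e j" if "i < n" "j < n" for i j x
    using phi[OF that, of x] de[OF that] by simp
  ultimately show thesis using that by blast
qed

lemma fmat_eq_sum_singles:
  fixes f :: "nat \<Rightarrow> nat \<Rightarrow> 'a::comm_monoid_add"
  assumes "f \<in> fmat n"
  shows "f = (\<Sum>(i, j)\<in>{..<n} \<times> {..<n}. single i j (f i j))"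
proof (intro ext)
  fix p q
  have "(\<Sum>(i, j)\<in>{..<n} \<times> {..<n}. single i j (f i j)) p q
    = (\<Sum>ij\<in>{..<n} \<times> {..<n}. if ij = (p, q) then f p q else 0)"
    unfolding sum_fun2_apply by (intro sum.cong) (auto simp: single_apply split: if_splits)
  also have "\<dots> = f p q" using assms by (auto simp: fmat_def)
  finally show "f p q = (\<Sum>(i, j)\<in>{..<n} \<times> {..<n}. single i j (f i j)) p q" by simp
qed

text \<open>The image of a unit is confined to one row and one column, so \<open>F\<close> acts on
  units by the scalar maps \<open>g i j\<close>. Images of blocks with vanishing subpermanent supply
  the condition of \<open>block_multiplicative_factor\<close>, and additivity extends the formula to
  all of \<open>fmat n\<close>.\<close>

lemma row_and_col_lines_form:
  fixes F :: "(nat \<Rightarrow> nat \<Rightarrow> 'a::field) \<Rightarrow> nat \<Rightarrow> nat \<Rightarrow> 'a"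
  assumes n: "n \<ge> 2" and F: "preserver n F"
    and \<sigma>: "row_lines n F \<sigma>" and \<tau>: "row_lines n (\<lambda>f. tr (F (tr f))) \<tau>"
  obtains \<phi> d e where "field_endomorphism \<phi>" "\<phi> 1 = 1"
    "\<And>i. i < n \<Longrightarrow> d i \<noteq> 0" "\<And>j. j < n \<Longrightarrow> e j \<noteq> 0"
    "\<And>f i j. f \<in> fmat n \<Longrightarrow> i < n \<Longrightarrow> j < n \<Longrightarrow> F f (\<sigma> i) (\<tau> j) = d i * \<phi> (f i j) * e j"
proof -
  define g where "g i j x = F (single i j x) (\<sigma> i) (\<tau> j)" for i j x
  have \<sigma>': "in_row (\<sigma> i) (F f)" if "i < n" "f \<in> row_mats n i" for i f
    using \<sigma> that unfolding row_lines_def by blast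
  have \<tau>': "in_row (\<tau> i) (tr (F (tr f)))" if "i < n" "f \<in> row_mats n i" for i f
    using \<tau> that unfolding row_lines_def by blast
  have inj: "\<sigma> i = \<sigma> k \<longleftrightarrow> i = k" "\<tau> i = \<tau> k \<longleftrightarrow> i = k" if "i < n" "k < n" for i k
    using \<sigma> \<tau> that unfolding row_lines_def inj_on_def by auto
  have Fs: "F (single i j x) = single (\<sigma> i) (\<tau> j) (g i j x)" if "i < n" "j < n" for i j x
    using \<sigma>'[OF that(1), of "single i j x"] \<tau>'[OF that(2), of "single j i x"] that
    by (auto simp: in_row_def single_apply fun_eq_iff g_def)
  have add: "g i j (x + y) = g i j x + g i j y" if "i < n" "j < n" for i j x y
    using that by (simp add: g_def single_add preserver_add[OF F])
  have nz: "g i j x \<noteq> 0" if "i < n" "j < n" "x \<noteq> 0" for i j x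
    using preserver_nonzero[OF F, of "single i j x"] that Fs[OF that(1,2), of x] by auto
  have block: "g i j x * g k l w + g i l y * g k j z = 0"
    if "i < n" "k < n" "j < n" "l < n" "i \<noteq> k" "j \<noteq> l" "x * w + y * z = 0" for i k j l x y z w
  proof -
    let ?f = "single i j x + single i l y + (single k j z + single k l w)"
    have "perm2_zero (F ?f)"
      using that by (intro preserver_perm2_zero[OF F]) (auto intro!: fmat_add perm2_zero_block)
    moreover have "F ?f = single (\<sigma> i) (\<tau> j) (g i j x) + single (\<sigma> i) (\<tau> l) (g i l y)
      + (single (\<sigma> k) (\<tau> j) (g k j z) + single (\<sigma> k) (\<tau> l) (g k l w))"
      using that by (simp add: preserver_add[OF F] fmat_add Fs)
    ultimately show ?thesis
      using perm2_zeroD[of "F ?f" "\<sigma> i" "\<sigma> k" "\<tau> j" "\<tau> l"] inj that by (auto simp: single_apply)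
  qed
  obtain \<phi> d e where *: "field_endomorphism \<phi>" "\<phi> 1 = 1"
    "\<And>i. i < n \<Longrightarrow> d i \<noteq> 0" "\<And>j. j < n \<Longrightarrow> e j \<noteq> 0"
    "\<And>i j x. i < n \<Longrightarrow> j < n \<Longrightarrow> g i j x = d i * \<phi> x * e j"
    by (rule block_multiplicative_factor[OF n add nz block]) blast+
  have "F f (\<sigma> i) (\<tau> j) = d i * \<phi> (f i j) * e j" if f: "f \<in> fmat n" and ij: "i < n" "j < n" for f i j
  proof -
    have "F f = F (\<Sum>(k, l)\<in>{..<n} \<times> {..<n}. single k l (f k l))"
      using fmat_eq_sum_singles[OF f] by simp
    also have "\<dots> = (\<Sum>(k, l)\<in>{..<n} \<times> {..<n}. F (single k l (f k l)))"
      by (subst preserver_sum[OF F]) (auto simp: case_prod_unfold)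
    finally have "F f (\<sigma> i) (\<tau> j)
      = (\<Sum>kl\<in>{..<n} \<times> {..<n}. (case kl of (k, l) \<Rightarrow> F (single k l (f k l))) (\<sigma> i) (\<tau> j))"
      by (simp only: sum_fun2_apply)
    also have "\<dots> = (\<Sum>kl\<in>{..<n} \<times> {..<n}. if kl = (i, j) then g i j (f i j) else 0)"
      using ij by (intro sum.cong) (auto simp: Fs single_apply inj split: if_splits)
    finally have "F f (\<sigma> i) (\<tau> j)
      = (\<Sum>kl\<in>{..<n} \<times> {..<n}. if kl = (i, j) then g i j (f i j) else 0)" .
    thus ?thesis using ij *(5) by simp
  qed
  with * show thesis using that by blast
qed

section \<open>Permanent rank one in terms of 2 by 2 subpermanents\<close>

text \<open>Padding with zero yields an element of \<open>fmat n\<close>, free of unspecified values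
  outside the index range.\<close>

definition entries :: "nat \<Rightarrow> 'a::zero mat \<Rightarrow> nat \<Rightarrow> nat \<Rightarrow> 'a" where
  "entries n A = (\<lambda>i j. if i < n \<and> j < n then A $$ (i, j) else 0)"

lemma entries_in_fmat [simp]: "entries n A \<in> fmat n"
  by (auto simp: entries_def fmat_def)

lemma entries_mat [simp]: "f \<in> fmat n \<Longrightarrow> entries n (mat n n (\<lambda>(i, j). f i j)) = f"
  by (auto simp: entries_def fmat_def fun_eq_iff)

lemma mat_entries: "A \<in> carrier_mat n n \<Longrightarrow> mat n n (\<lambda>(i, j). entries n A i j) = A"
  by (auto simp: entries_def)

lemma entries_add:
  assumes "A \<in> carrier_mat n n" "B \<in> carrier_mat n n"
  shows "entries n (A + B) = entries n A + entries n (B :: 'a::monoid_add mat)"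
  using assms by (auto simp: entries_def fun_eq_iff)

lemma pick_inject: "i < card S \<Longrightarrow> j < card S \<Longrightarrow> pick S i = pick S j \<longleftrightarrow> i = j"
  using pick_mono_le[of i S j] pick_mono_le[of j S i] by (cases i j rule: linorder_cases) auto

lemma permanent_submatrix:
  assumes A: "A \<in> carrier_mat n n" and IJ: "I \<subseteq> {..<n}" "J \<subseteq> {..<n}" "card I = m" "card J = m"
  shows "permanent (submatrix A I J)
    = (\<Sum>p\<in>{p. p permutes {0..<m}}. \<Prod>i = 0..<m. entries n A (pick I i) (pick J (p i)))"
proof -
  have I: "{i. i < dim_row A \<and> i \<in> I} = I" and J: "{j. j < dim_col A \<and> j \<in> J} = J"
    using A IJ by auto
  have pick: "pick I i < n" "pick J i < n" if "i < m" for i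
    using pick_in_set_le[of i I] pick_in_set_le[of i J] that IJ by auto
  have "submatrix A I J $$ (i, p i) = entries n A (pick I i) (pick J (p i))"
    if "p permutes {0..<m}" "i < m" for p i
  proof -
    have "p i < m" using permutes_in_image[OF that(1), of i] that(2) by simp
    thus ?thesis using that(2) pick IJ submatrix_index[of i A I "p i" J] unfolding I J
      by (simp add: entries_def)
  qed
  thus ?thesis unfolding permanent_def dim_submatrix I J IJ(3,4) by (auto intro!: sum.cong prod.cong)
qed

lemma sum_permutations_eq_0:
  fixes b :: "nat \<Rightarrow> nat \<Rightarrow> 'a::field"
  assumes two: "(2::'a) \<noteq> 0" and m: "m \<ge> 2"
    and b: "\<And>j l. j < m \<Longrightarrow> l < m \<Longrightarrow> j \<noteq> l \<Longrightarrow> b 0 j * b 1 l + b 0 l * b 1 j = 0"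
  shows "(\<Sum>p\<in>{p. p permutes {0..<m}}. \<Prod>i = 0..<m. b i (p i)) = 0" (is "?S = 0")
proof -
  let ?t = "Transposition.transpose 0 (1::nat)"
  let ?f = "\<lambda>p. \<Prod>i = 0..<m. b i (p i)"
  have t: "?t permutes {0..<m}" using m by (intro permutes_swap_id) auto
  \<comment> \<open>Composition with \<open>?t\<close> pairs each permutation with one that gives the opposite product.\<close>
  have "?f p + ?f (p \<circ> ?t) = 0" if p: "p permutes {0..<m}" for p
  proof -
    have set: "{0..<m} = insert 0 (insert 1 {2..<m})" using m by auto
    have split: "?f q = b 0 (q 0) * b 1 (q 1) * (\<Prod>i = 2..<m. b i (q i))" for q
      unfolding set by (simp add: mult.assoc)
    have "(\<Prod>i = 2..<m. b i ((p \<circ> ?t) i)) = (\<Prod>i = 2..<m. b i (p i))"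
      by (intro prod.cong) (auto simp: Transposition.transpose_def)
    hence "?f p + ?f (p \<circ> ?t) = (b 0 (p 0) * b 1 (p 1) + b 0 (p 1) * b 1 (p 0)) * (\<Prod>i = 2..<m. b i (p i))"
      unfolding split by (simp add: algebra_simps)
    moreover have "p 0 < m" "p 1 < m"
      using permutes_in_image[OF p, of 0] permutes_in_image[OF p, of 1] m by auto
    moreover have "p 0 \<noteq> p 1" using permutes_inj[OF p] by (auto dest: injD)
    ultimately show ?thesis using b by simp
  qed
  hence "(\<Sum>p\<in>{p. p permutes {0..<m}}. ?f p + ?f (p \<circ> ?t)) = 0" by (intro sum.neutral) auto
  \<comment> \<open>Reindexing by the transposition turns the sum over the pairs into
    \<open>2 * ?S\<close>; here 2 has to be invertible.\<close>
  moreover have "?S = (\<Sum>p\<in>{p. p permutes {0..<m}}. ?f (p \<circ> ?t))"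
    by (rule sum_permutations_compose_right[OF t])
  ultimately have "2 * ?S = 0" by (simp add: sum.distrib)
  thus ?thesis using two by simp
qed

text \<open>As \<open>permanent_rank\<close> is a maximum over all sizes, vanishing at size 2 has to
  propagate to larger sizes; this is \<open>sum_permutations_eq_0\<close> on the first two chosen
  rows.\<close>

lemma per_rank_one_iff_perm2_zero:
  fixes A :: "'a::field mat"
  assumes two: "(2::'a) \<noteq> 0" and A: "A \<in> carrier_mat n n"
  shows "A \<in> per_rank_one n \<longleftrightarrow> perm2_zero (entries n A) \<and> entries n A \<noteq> 0"
proof -
  let ?S = "{m. \<exists>I J. I \<subseteq> {..<dim_row A} \<and> J \<subseteq> {..<dim_col A} \<and>
    card I = m \<and> card J = m \<and> permanent (submatrix A I J) \<noteq> 0}"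
  have dim: "dim_row A = n" "dim_col A = n" using A by auto
  have fin: "finite ?S"
  proof (rule finite_subset)
    show "?S \<subseteq> {..n}" unfolding dim using card_mono[of "{..<n}"] by fastforce
  qed simp
  have "permanent (submatrix A {} {}) \<noteq> 0"
    using permanent_submatrix[OF A, of "{}" "{}" 0] by simp
  hence "0 \<in> ?S" by (intro CollectI exI[of _ "{}"]) simp
  have one: "1 \<in> ?S" if "entries n A \<noteq> 0"
  proof -
    from that obtain i j where ij: "entries n A i j \<noteq> 0" by (auto simp: fun_eq_iff)
    hence less: "i < n" "j < n" by (auto simp: entries_def split: if_splits)
    have "pick {i} 0 = i" "pick {j} 0 = j"
      using pick_in_set_le[of 0 "{i}"] pick_in_set_le[of 0 "{j}"] by auto
    hence "permanent (submatrix A {i} {j}) \<noteq> 0"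
      using permanent_submatrix[OF A, of "{i}" "{j}" 1] less ij by simp
    thus ?thesis unfolding dim using less by (intro CollectI exI[of _ "{i}"] exI[of _ "{j}"]) simp
  qed
  have one': "entries n A \<noteq> 0" if "1 \<in> ?S"
  proof
    assume "entries n A = 0"
    from that obtain I J where IJ: "I \<subseteq> {..<n}" "J \<subseteq> {..<n}" "card I = 1" "card J = 1"
      "permanent (submatrix A I J) \<noteq> 0" unfolding dim by blast
    show False using IJ(5) permanent_submatrix[OF A IJ(1-4)] \<open>entries n A = 0\<close> by simp
  qed
  have big: "m < 2" if "perm2_zero (entries n A)" "m \<in> ?S" for m
  proof (rule ccontr)
    assume m: "\<not> m < 2"
    from that obtain I J where IJ: "I \<subseteq> {..<n}" "J \<subseteq> {..<n}" "card I = m" "card J = m"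
      "permanent (submatrix A I J) \<noteq> 0" unfolding dim by blast
    have "pick I 0 \<noteq> pick I 1" using pick_inject[of 0 I 1] IJ m by auto
    moreover have "pick J j \<noteq> pick J l" if "j < m" "l < m" "j \<noteq> l" for j l
      using pick_inject[of j J l] IJ that by auto
    ultimately have "permanent (submatrix A I J) = 0"
      unfolding permanent_submatrix[OF A IJ(1-4)] using m perm2_zeroD[OF that(1)]
      by (intro sum_permutations_eq_0[OF two]) auto
    thus False using IJ by simp
  qed
  have two_mem: "2 \<in> ?S" if ng: "\<not> perm2_zero (entries n A)"
  proof -
    from ng obtain i k j l where ne: "i \<noteq> k" "j \<noteq> l"
      "entries n A i j * entries n A k l + entries n A i l * entries n A k j \<noteq> 0" unfolding perm2_zero_def by blast
    hence less: "i < n" "k < n" "j < n" "l < n" by (auto simp: entries_def split: if_splits)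
    \<comment> \<open>\<open>pick\<close> lists a set in increasing order, so either element can
      come first; the 2 by 2 permanent is not affected.\<close>
    have picks: "pick {a, b} 0 = a \<and> pick {a, b} 1 = b \<or> pick {a, b} 0 = b \<and> pick {a, b} 1 = a"
      if "a \<noteq> b" for a b
      using pick_in_set_le[of 0 "{a, b}"] pick_in_set_le[of 1 "{a, b}"] pick_inject[of 0 "{a, b}" 1] that
      by auto
    have "{0..<2} = {0, 1::nat}" by auto
    hence "permanent (submatrix A {i, k} {j, l})
      = entries n A (pick {i, k} 0) (pick {j, l} 0) * entries n A (pick {i, k} 1) (pick {j, l} 1)
      + entries n A (pick {i, k} 0) (pick {j, l} 1) * entries n A (pick {i, k} 1) (pick {j, l} 0)"
      using permanent_submatrix[OF A, of "{i, k}" "{j, l}" 2] less ne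
      by (simp add: permutes_doubleton_iff Collect_disj_eq transpose_eq_id_iff eq_commute[of id])
    also have "\<dots> = entries n A i j * entries n A k l + entries n A i l * entries n A k j"
      using picks[OF ne(1)] picks[OF ne(2)] by (elim disjE conjE) (simp_all add: algebra_simps)
    finally show ?thesis using less ne unfolding dim
      by (intro CollectI exI[of _ "{i, k}"] exI[of _ "{j, l}"]) simp
  qed
  have "permanent_rank A = 1 \<longleftrightarrow> perm2_zero (entries n A) \<and> entries n A \<noteq> 0"
  proof
    assume "permanent_rank A = 1"
    hence r: "Max ?S = 1" by (simp only: permanent_rank_def)
    have "?S \<noteq> {}" using \<open>0 \<in> ?S\<close> by (metis empty_iff)
    from Max_in[OF fin this] have "1 \<in> ?S" unfolding r .
    moreover have "2 \<notin> ?S"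
    proof
      assume "2 \<in> ?S"
      from Max_ge[OF fin this] show False unfolding r by simp
    qed
    ultimately show "perm2_zero (entries n A) \<and> entries n A \<noteq> 0" using one' two_mem by blast
  next
    assume g: "perm2_zero (entries n A) \<and> entries n A \<noteq> 0"
    show "permanent_rank A = 1" unfolding permanent_rank_def
    proof (rule Max_eqI[OF fin])
      show "m \<le> 1" if "m \<in> ?S" for m using big[OF conjunct1[OF g] that] by linarith
      show "1 \<in> ?S" by (rule one[OF conjunct2[OF g]])
    qed
  qed
  thus ?thesis using A unfolding per_rank_one_def by simp
qed

section \<open>Products with permutation and diagonal matrices\<close>

lemma map_matrix_index:
  assumes "r < n" "s < n"
  shows "map_matrix n \<sigma> $$ (r, s) = (if s = \<sigma> r then 1 else 0 :: 'a::comm_ring_1)"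
proof -
  have "map_matrix n \<sigma> $$ (r, s) = (\<Sum>i<n. if r = i \<and> s = \<sigma> i then 1 else 0 :: 'a)"
    using assms by (simp add: map_matrix_def matrix_unit_def)
  also have "\<dots> = (\<Sum>i<n. if i = r then (if s = \<sigma> r then 1 else 0) else 0)"
    by (intro sum.cong) auto
  finally have "map_matrix n \<sigma> $$ (r, s) = (\<Sum>i<n. if i = r then (if s = \<sigma> r then 1 else 0) else 0 :: 'a)" .
  thus ?thesis using assms by simp
qed

text \<open>By injectivity, row \<open>\<sigma> i\<close> of the transposed matrix has its only
  nonzero entry in column \<open>i\<close>, and column \<open>\<tau> j\<close> of the last factor
  has its own in row \<open>j\<close>. So each sum has a single surviving term.\<close>

lemma monomial_product_index:
  fixes M :: "'a::field mat"
  assumes M: "M \<in> carrier_mat n n"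
    and \<sigma>: "\<sigma> \<in> {..<n} \<rightarrow> {..<n}" "inj_on \<sigma> {..<n}" and \<tau>: "\<tau> \<in> {..<n} \<rightarrow> {..<n}" "inj_on \<tau> {..<n}"
    and ij: "i < n" "j < n"
  shows "((map_matrix n \<sigma>)\<^sup>T * mat n n (\<lambda>(r, s). if r = s then d r else 0) * M
    * mat n n (\<lambda>(r, s). if r = s then e r else 0) * map_matrix n \<tau>) $$ (\<sigma> i, \<tau> j) = d i * M $$ (i, j) * e j"
proof -
  define D1 where "D1 = mat n n (\<lambda>(r, s). if r = s then d r else 0)"
  define D2 where "D2 = mat n n (\<lambda>(r, s). if r = s then e r else 0)"
  define X1 where "X1 = (map_matrix n \<sigma>)\<^sup>T * D1"
  define X2 where "X2 = X1 * M"
  define X3 where "X3 = X2 * D2"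
  have carr: "(map_matrix n \<sigma> :: 'a mat) \<in> carrier_mat n n" "(map_matrix n \<tau> :: 'a mat) \<in> carrier_mat n n"
    "D1 \<in> carrier_mat n n" "D2 \<in> carrier_mat n n"
    by (simp_all add: map_matrix_def D1_def D2_def)
  hence X: "X1 \<in> carrier_mat n n" "X2 \<in> carrier_mat n n" "X3 \<in> carrier_mat n n"
    using M by (auto simp: X1_def X2_def X3_def)
  have mult: "(B * C) $$ (p, q) = (\<Sum>k<n. B $$ (p, k) * C $$ (k, q))"
    if "B \<in> carrier_mat n n" "C \<in> carrier_mat n n" "p < n" "q < n" for B C :: "'a mat" and p q
    using that by (auto simp: scalar_prod_def atLeast0LessThan intro!: sum.cong)
  have \<sigma>i: "\<sigma> i < n" "\<tau> j < n" using \<sigma> \<tau> ij by auto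
  have 1: "X1 $$ (\<sigma> i, k) = (if k = i then d i else 0)" if k: "k < n" for k
  proof -
    have "X1 $$ (\<sigma> i, k) = (\<Sum>m<n. (map_matrix n \<sigma>)\<^sup>T $$ (\<sigma> i, m) * D1 $$ (m, k))"
      unfolding X1_def using carr \<sigma>i k by (intro mult) auto
    also have "\<dots> = (\<Sum>m<n. if m = i then (if k = i then d i else 0) else 0)"
    proof (intro sum.cong refl)
      fix m assume m: "m \<in> {..<n}"
      have "\<sigma> i = \<sigma> m \<longleftrightarrow> m = i" using inj_on_eq_iff[OF \<sigma>(2), of i m] ij m by auto
      thus "(map_matrix n \<sigma>)\<^sup>T $$ (\<sigma> i, m) * D1 $$ (m, k) = (if m = i then if k = i then d i else 0 else 0)"
        using m k \<sigma>i carr by (auto simp: map_matrix_index D1_def)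
    qed
    finally show ?thesis using ij by simp
  qed
  have 2: "X2 $$ (\<sigma> i, l) = d i * M $$ (i, l)" if l: "l < n" for l
  proof -
    have "X2 $$ (\<sigma> i, l) = (\<Sum>k<n. X1 $$ (\<sigma> i, k) * M $$ (k, l))"
      unfolding X2_def using M X \<sigma>i l by (intro mult) auto
    also have "\<dots> = (\<Sum>k<n. if k = i then d i * M $$ (i, l) else 0)"
      by (intro sum.cong) (auto simp: 1)
    finally show ?thesis using ij by simp
  qed
  have 3: "X3 $$ (\<sigma> i, l) = d i * M $$ (i, l) * e l" if l: "l < n" for l
  proof -
    have "X3 $$ (\<sigma> i, l) = (\<Sum>k<n. X2 $$ (\<sigma> i, k) * D2 $$ (k, l))"
      unfolding X3_def using carr X \<sigma>i l by (intro mult) auto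
    also have "\<dots> = (\<Sum>k<n. if k = l then d i * M $$ (i, l) * e l else 0)"
      using l by (intro sum.cong) (auto simp: 2 D2_def)
    finally show ?thesis using l by simp
  qed
  have "(X3 * map_matrix n \<tau>) $$ (\<sigma> i, \<tau> j) = (\<Sum>l<n. X3 $$ (\<sigma> i, l) * map_matrix n \<tau> $$ (l, \<tau> j))"
    using carr X \<sigma>i by (intro mult) auto
  also have "\<dots> = (\<Sum>l<n. if l = j then d i * M $$ (i, j) * e j else 0)"
  proof (intro sum.cong refl)
    fix l assume l: "l \<in> {..<n}"
    have "\<tau> j = \<tau> l \<longleftrightarrow> l = j" using inj_on_eq_iff[OF \<tau>(2), of j l] ij l by auto
    thus "X3 $$ (\<sigma> i, l) * map_matrix n \<tau> $$ (l, \<tau> j) = (if l = j then d i * M $$ (i, j) * e j else 0)"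
      using l \<sigma>i by (auto simp: 3 map_matrix_index)
  qed
  finally show ?thesis using ij unfolding X3_def X2_def X1_def D1_def D2_def by simp
qed

lemma nonzero_diagonal_mat:
  "(\<And>i. i < n \<Longrightarrow> d i \<noteq> 0) \<Longrightarrow> nonzero_diagonal n (mat n n (\<lambda>(r, s). if r = s then d r else 0))"
  by (simp add: nonzero_diagonal_def diagonal_mat_def)

text \<open>Injective self-maps of a finite set are onto, so the positions
  \<open>(\<sigma> i, \<tau> j)\<close> exhaust the matrix.\<close>

lemma eq_monomial_product:
  fixes M B :: "'a::field mat"
  assumes M: "M \<in> carrier_mat n n" and B: "B \<in> carrier_mat n n"
    and \<sigma>: "\<sigma> \<in> {..<n} \<rightarrow> {..<n}" "inj_on \<sigma> {..<n}" and \<tau>: "\<tau> \<in> {..<n} \<rightarrow> {..<n}" "inj_on \<tau> {..<n}"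
    and eq: "\<And>i j. i < n \<Longrightarrow> j < n \<Longrightarrow> B $$ (\<sigma> i, \<tau> j) = d i * M $$ (i, j) * e j"
  shows "B = (map_matrix n \<sigma>)\<^sup>T * mat n n (\<lambda>(r, s). if r = s then d r else 0) * M
    * mat n n (\<lambda>(r, s). if r = s then e r else 0) * map_matrix n \<tau>" (is "B = ?R")
proof (rule eq_matI)
  have surj: "\<sigma> ` {..<n} = {..<n}" "\<tau> ` {..<n} = {..<n}"
    by (rule endo_inj_surj; use \<sigma> \<tau> in auto)+
  fix p q assume "p < dim_row ?R" "q < dim_col ?R"
  hence "p \<in> \<sigma> ` {..<n}" "q \<in> \<tau> ` {..<n}" unfolding surj by (simp_all add: map_matrix_def)
  then obtain i j where "p = \<sigma> i" "q = \<tau> j" "i < n" "j < n" by auto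
  thus "B $$ (p, q) = ?R $$ (p, q)"
    using monomial_product_index[OF M \<sigma> \<tau>] eq by simp
qed (use B in \<open>simp_all add: map_matrix_def\<close>)

section \<open>Transfer to matrices\<close>

definition entry_map :: "nat \<Rightarrow> ('a::zero mat \<Rightarrow> 'a mat) \<Rightarrow> (nat \<Rightarrow> nat \<Rightarrow> 'a) \<Rightarrow> nat \<Rightarrow> nat \<Rightarrow> 'a" where
  "entry_map n \<Phi> f = entries n (\<Phi> (mat n n (\<lambda>(i, j). f i j)))"

lemma preserver_entry_map:
  fixes \<Phi> :: "'a::field mat \<Rightarrow> 'a mat"
  assumes two: "(2::'a) \<noteq> 0" and carr: "\<Phi> \<in> carrier_mat n n \<rightarrow> carrier_mat n n"
    and add: "additive_on_mat n \<Phi>" and sub: "\<Phi> ` per_rank_one n \<subseteq> per_rank_one n"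
  shows "preserver n (entry_map n \<Phi>)"
  unfolding preserver_def entry_map_def
proof (intro conjI ballI impI)
  fix f g :: "nat \<Rightarrow> nat \<Rightarrow> 'a"
  have "mat n n (\<lambda>(i, j). (f + g) i j) = mat n n (\<lambda>(i, j). f i j) + mat n n (\<lambda>(i, j). g i j)"
    by auto
  thus "entries n (\<Phi> (mat n n (\<lambda>(i, j). (f + g) i j)))
    = entries n (\<Phi> (mat n n (\<lambda>(i, j). f i j))) + entries n (\<Phi> (mat n n (\<lambda>(i, j). g i j)))"
    using add carr unfolding additive_on_mat_def
    by (subst entries_add[symmetric]) (auto simp del: plus_fun_apply)
next
  fix f :: "nat \<Rightarrow> nat \<Rightarrow> 'a" assume f: "f \<in> fmat n" "perm2_zero f" "f \<noteq> 0"
  let ?A = "mat n n (\<lambda>(i, j). f i j)"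
  have "?A \<in> per_rank_one n" using per_rank_one_iff_perm2_zero[OF two, of ?A n] f by simp
  hence "\<Phi> ?A \<in> per_rank_one n" using sub by blast
  moreover have "\<Phi> ?A \<in> carrier_mat n n" using carr by auto
  ultimately show "perm2_zero (entries n (\<Phi> ?A))" "entries n (\<Phi> ?A) \<noteq> 0" using per_rank_one_iff_perm2_zero[OF two] by auto
qed simp

lemma rigid_entry_map:
  fixes \<Phi> :: "'a::field mat \<Rightarrow> 'a mat"
  assumes two: "(2::'a) \<noteq> 0" and carr: "\<Phi> \<in> carrier_mat n n \<rightarrow> carrier_mat n n"
    and F: "preserver n (entry_map n \<Phi>)"
    and alt: "\<Phi> ` carrier_mat n n = carrier_mat n n \<or> preserves_per_rank_one_both n \<Phi>"
  shows "rigid n (entry_map n \<Phi>)" (is "rigid n ?F")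
  using alt
proof
  assume surj: "\<Phi> ` carrier_mat n n = carrier_mat n n"
  have "g \<in> ?F ` fmat n" if "g \<in> fmat n" for g
  proof -
    obtain A where A: "A \<in> carrier_mat n n" "\<Phi> A = mat n n (\<lambda>(i, j). g i j)"
      using surj by (metis imageE mat_carrier)
    hence "g = ?F (entries n A)" using that by (simp add: entry_map_def mat_entries)
    thus ?thesis using image_eqI[of g "?F" "entries n A" "fmat n"] by simp
  qed
  moreover have "?F f \<in> fmat n" if "f \<in> fmat n" for f using preserver_fmat[OF F that] .
  ultimately have "?F ` fmat n = fmat n" by auto
  thus ?thesis unfolding rigid_def ..
next
  assume both: "preserves_per_rank_one_both n \<Phi>"
  have perm2_zeroI: "perm2_zero f" if "f \<in> fmat n" "perm2_zero (?F f)" "?F f \<noteq> 0" for f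
  proof -
    let ?A = "mat n n (\<lambda>(i, j). f i j)"
    have "\<Phi> ?A \<in> carrier_mat n n" using carr by auto
    hence "\<Phi> ?A \<in> per_rank_one n"
      using per_rank_one_iff_perm2_zero[OF two] that(2,3) unfolding entry_map_def by blast
    hence "?A \<in> per_rank_one n"
      using both mat_carrier unfolding preserves_per_rank_one_both_def by blast
    thus ?thesis using per_rank_one_iff_perm2_zero[OF two, of ?A n] that by simp
  qed
  have "separating n ?F"
    unfolding separating_def
  proof (intro allI impI notI)
    fix i k j l
    assume ij: "i < n" "k < n" "j < n" "l < n" "i \<noteq> k" "j \<noteq> l"
      and perm2_zero: "perm2_zero (?F (single i j 1 + single k l 1))"
    let ?f = "single i j 1 + single k l (1::'a)"
    have f: "?f \<in> fmat n" "single i j 1 + ?f \<in> fmat n"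
      by (intro fmat_add single_in_fmat ij)+
    show False
    proof (cases "?F ?f = 0")
      case False
      hence "perm2_zero ?f" using perm2_zeroI[OF f(1) perm2_zero] by blast
      thus False using perm2_zeroD[of ?f i k j l] ij by (simp add: single_apply)
    next
      case True
      \<comment> \<open>If \<open>?f\<close> is sent to zero, adding it to
        \<open>single i j 1\<close> keeps the image but creates a subpermanent equal to 2.\<close>
      have eq: "?F (single i j 1 + ?f) = ?F (single i j 1)"
        unfolding preserver_add[OF F single_in_fmat[OF ij(1,3)] f(1)] True by (rule add_0_right)
      have "?F (single i j 1) \<noteq> 0" "perm2_zero (?F (single i j 1))"
        by (rule preserver_nonzero[OF F], use ij in simp_all) (rule preserver_perm2_zero[OF F], use ij in simp_all)
      with perm2_zeroI[OF f(2)] have "perm2_zero (single i j 1 + ?f)" unfolding eq by blast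
      thus False using perm2_zeroD[of "single i j 1 + ?f" i k j l] ij two by (simp add: single_apply)
    qed
  qed
  thus ?thesis unfolding rigid_def ..
qed

theorem theorem1p6:
  fixes n :: nat and \<Phi> :: "'a :: field mat \<Rightarrow> 'a mat"
  assumes "CHAR('a) \<noteq> 2"
    and "n \<ge> 3"
    and "\<Phi> \<in> carrier_mat n n \<rightarrow> carrier_mat n n"
    and "additive_on_mat n \<Phi>"
    and "\<Phi> ` per_rank_one n \<subseteq> per_rank_one n"
    and "\<Phi> ` carrier_mat n n = carrier_mat n n \<or> preserves_per_rank_one_both n \<Phi>"
  shows "\<exists>\<sigma> \<tau> D1 D2 \<phi>.
    \<sigma> \<in> {..<n} \<rightarrow> {..<n} \<and> inj_on \<sigma> {..<n} \<and>
    \<tau> \<in> {..<n} \<rightarrow> {..<n} \<and> inj_on \<tau> {..<n} \<and>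
    nonzero_diagonal n D1 \<and> nonzero_diagonal n D2 \<and>
    field_endomorphism \<phi> \<and> \<phi> \<noteq> (\<lambda>x. 0) \<and>
    ((\<forall>A \<in> carrier_mat n n.
        \<Phi> A = (map_matrix n \<sigma>)\<^sup>T * D1 * map_mat \<phi> A * D2 * map_matrix n \<tau>) \<or>
     (\<forall>A \<in> carrier_mat n n.
        \<Phi> A = (map_matrix n \<sigma>)\<^sup>T * D1 * (map_mat \<phi> A)\<^sup>T * D2 * map_matrix n \<tau>))"
proof -
  have two: "(2::'a) \<noteq> 0"
  proof
    assume "(2::'a) = 0"
    hence "of_nat 2 = (0::'a)" by simp
    hence dvd: "CHAR('a) dvd 2" by (simp only: of_nat_eq_0_iff_char_dvd)
    hence "CHAR('a) \<noteq> 0" by (metis dvd_0_left_iff zero_neq_numeral)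
    moreover have "CHAR('a) \<le> 2" using dvd by (rule dvd_imp_le) simp
    ultimately have "CHAR('a) = 1" using assms(1) by linarith
    thus False using of_nat_CHAR[where 'a = 'a] by simp
  qed
  define F where "F = entry_map n \<Phi>"
  have F: "preserver n F"
    unfolding F_def by (rule preserver_entry_map[OF two assms(3-5)])
  have rigid: "rigid n F"
    unfolding F_def by (rule rigid_entry_map[OF two assms(3) F[unfolded F_def] assms(6)])
  have carr: "\<Phi> A \<in> carrier_mat n n" if "A \<in> carrier_mat n n" for A using assms(3) that by auto
  have F_entries: "F (entries n A) i j = \<Phi> A $$ (i, j)" if "A \<in> carrier_mat n n" "i < n" "j < n" for A i j
    using that by (simp add: F_def entry_map_def mat_entries) (simp add: entries_def)
  have n2: "n \<ge> 2" using assms(2) by simp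
  from two assms(2) F rigid show ?thesis
  proof (cases rule: rigid_rows_and_cols)
    case (1 \<sigma> \<tau>)
    hence \<sigma>\<tau>: "\<sigma> \<in> {..<n} \<rightarrow> {..<n}" "inj_on \<sigma> {..<n}" "\<tau> \<in> {..<n} \<rightarrow> {..<n}" "inj_on \<tau> {..<n}"
      by (simp_all add: row_lines_def)
    obtain \<phi> d e where \<phi>: "field_endomorphism \<phi>" "\<phi> 1 = 1"
      and d: "\<And>i. i < n \<Longrightarrow> d i \<noteq> 0" and e: "\<And>j. j < n \<Longrightarrow> e j \<noteq> 0"
      and form: "\<And>f i j. f \<in> fmat n \<Longrightarrow> i < n \<Longrightarrow> j < n \<Longrightarrow> F f (\<sigma> i) (\<tau> j) = d i * \<phi> (f i j) * e j"
      using row_and_col_lines_form[OF n2 F 1] by metis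
    have "\<phi> \<noteq> (\<lambda>x. 0)" using \<phi>(2) by auto
    moreover have "\<Phi> A = (map_matrix n \<sigma>)\<^sup>T * mat n n (\<lambda>(r, s). if r = s then d r else 0) * map_mat \<phi> A
      * mat n n (\<lambda>(r, s). if r = s then e r else 0) * map_matrix n \<tau>" if A: "A \<in> carrier_mat n n" for A
    proof (rule eq_monomial_product[OF _ carr[OF A] \<sigma>\<tau>])
      fix i j assume ij: "i < n" "j < n"
      hence "\<sigma> i < n" "\<tau> j < n" using \<sigma>\<tau> by auto
      moreover have "entries n A i j = A $$ (i, j)" using ij by (simp add: entries_def)
      ultimately show "\<Phi> A $$ (\<sigma> i, \<tau> j) = d i * map_mat \<phi> A $$ (i, j) * e j"
        using form[OF entries_in_fmat ij, of A] F_entries[OF A] A ij by simp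
    qed (use A in simp)
    ultimately show ?thesis
      using \<sigma>\<tau> \<phi> nonzero_diagonal_mat[of n d, OF d] nonzero_diagonal_mat[of n e, OF e] by blast
  next
    case (2 \<sigma> \<tau>)
    hence \<sigma>\<tau>: "\<tau> \<in> {..<n} \<rightarrow> {..<n}" "inj_on \<tau> {..<n}" "\<sigma> \<in> {..<n} \<rightarrow> {..<n}" "inj_on \<sigma> {..<n}"
      by (simp_all add: row_lines_def)
    \<comment> \<open>Two cancelling transpositions bring the column statement into the form
      required for the map \<open>\<lambda>f. tr (F f)\<close>.\<close>
    have lines: "row_lines n (\<lambda>f. tr (tr (F (tr f)))) \<tau>" using 2(2) by simp
    obtain \<phi> d e where \<phi>: "field_endomorphism \<phi>" "\<phi> 1 = 1"
      and d: "\<And>i. i < n \<Longrightarrow> d i \<noteq> 0" and e: "\<And>j. j < n \<Longrightarrow> e j \<noteq> 0"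
      and form: "\<And>f i j. f \<in> fmat n \<Longrightarrow> i < n \<Longrightarrow> j < n \<Longrightarrow> tr (F f) (\<sigma> i) (\<tau> j) = d i * \<phi> (f i j) * e j"
      using row_and_col_lines_form[OF n2 preserver_tr_comp[OF F] 2(1) lines] by metis
    have "\<phi> \<noteq> (\<lambda>x. 0)" using \<phi>(2) by auto
    \<comment> \<open>\<open>form\<close> describes the transposed image, so \<open>\<tau>\<close>
      and \<open>e\<close> move to the row side and \<open>\<sigma>\<close> and \<open>d\<close> to
      the column side.\<close>
    moreover have "\<Phi> A = (map_matrix n \<tau>)\<^sup>T * mat n n (\<lambda>(r, s). if r = s then e r else 0) * (map_mat \<phi> A)\<^sup>T
      * mat n n (\<lambda>(r, s). if r = s then d r else 0) * map_matrix n \<sigma>" if A: "A \<in> carrier_mat n n" for A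
    proof (rule eq_monomial_product[OF _ carr[OF A] \<sigma>\<tau>])
      fix j i assume ij: "j < n" "i < n"
      hence "\<sigma> i < n" "\<tau> j < n" using \<sigma>\<tau> by auto
      moreover have "entries n A i j = A $$ (i, j)" using ij by (simp add: entries_def)
      ultimately show "\<Phi> A $$ (\<tau> j, \<sigma> i) = e j * (map_mat \<phi> A)\<^sup>T $$ (j, i) * d i"
        using form[OF entries_in_fmat ij(2,1), of A] F_entries[OF A] A ij by (simp add: mult.commute mult.left_commute)
    qed (use A in simp)
    ultimately show ?thesis
      using \<sigma>\<tau> \<phi> nonzero_diagonal_mat[of n d, OF d] nonzero_diagonal_mat[of n e, OF e] by blast
  qed
qed

end
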